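(* Let $k$ be a field and let $C$ be a finite, connected, non-empty simplicial complex. Let $|C|$ be its geometric realization, and let $\mathrm{Pos}(C)$ be the poset of non-empty simplexes of $C$ ordered by inclusion. Then the topological fundamental group $\Pi_1(|C|)$ and the algebraic fundamental group $\Pi_1(\mathrm{Pos}(C))$ are isomorphic.
   Context: A simplicial complex consists of a set of vertices together with a family of finite sets of vertices, called simplexes, such that every subset of a simplex is a simplex and every one-element set of vertices is a simplex. It is finite if its vertex set is finite. It is connected if any two vertices $s,t$ can be joined by vertices $s=s_0,\dots,s_n=t$ with each $\{s_{i-1},s_i\}$ a simplex. Ordered quiver of a poset: to a finite poset $P$ one associates the quiver $Q$ whose vertices are the elements of $P$, with exactly one arrow from $a$ to $b$ if $a<b$ and no element of $P$ lies strictly between $a$ and $b$, and no other arrows. Path algebra and parallel ideal: $kQ$ is the $k$-vector space with basis the paths of $Q$ (vertices being paths of length $0$), with multiplication given by composition of paths when possible and $0$ otherwise. Two paths are parallel if they have the same beginning and the same end. The parallel ideal $I_Q$ is the two-sided ideal of $kQ$ spanned by all differences of two parallel paths. The incidence algebra is $kQ/I_Q$. Algebraic fundamental group: let $Q$ be a connected quiver and $I$ an ideal of $kQ$. A sum $\sum_{i=1}^n\lambda_i\omega_i$ (with $\lambda_i\in k$ nonzero, $\omega_i$ distinct paths) is a minimal relation if it lies in $I$ and for every non-empty proper subset $J\subset\{1,\dots,n\}$ the sum $\sum_{i\in J}\lambda_i\omega_i$ is not in $I$. For an arrow $\alpha$ from $x$ to $y$, $\alpha^{-1}$ denotes a formal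 inverse from $y$ to $x$. A walk is a composable formal product of arrows and formal inverses of arrows (products are composed from right to left); $e_x$ is the trivial walk at the vertex $x$; a loop is a walk whose two extremities coincide. Let $\sim$ be the smallest equivalence relation on walks such that: (1) $\alpha\alpha^{-1}\sim e_y$ and $\alpha^{-1}\alpha\sim e_x$ for every arrow $\alpha$ from $x$ to $y$; (2) $\omega_1\sim\dots\sim\omega_n$ for every minimal relation $\sum_{i=1}^n\lambda_i\omega_i$; (3) if $\alpha\sim\beta$ then $\omega\alpha\omega'\sim\omega\beta\omega'$ for all walks $\omega,\omega'$ for which the products are defined. $\Pi_1(Q,I)$ is the group of equivalence classes of loops at a fixed vertex $x_0$, under concatenation; up to isomorphism it does not depend on $x_0$. For a connected poset $P$ with associated ordered quiver $Q$, $\Pi_1(P):=\Pi_1(Q,I_Q)$. (For $I=I_Q$, condition (2) says that parallel paths are equivalent.) *)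

theory Defs
  imports
    "HOL-Analysis.Analysis"
    "HOL-Analysis.Finite_Function_Topology"
    "HOL-Algebra.Ideal"
    "Graph_Theory.Arc_Walk"
begin

section \<open>Groups of classes\<close>

definition class_group ::
    "'a set \<Rightarrow> ('a \<times> 'a) set \<Rightarrow> ('a \<Rightarrow> 'a \<Rightarrow> 'a) \<Rightarrow> 'a \<Rightarrow> 'a set monoid" where
  "class_group L R f e =
     \<lparr>carrier = L // R, mult = (\<lambda>A B. \<Union>a\<in>A. \<Union>b\<in>B. R `` {f a b}), one = R `` {e}\<rparr>"

lemma class_group_mult:
  assumes R: "equiv L R"
    and cong: "\<And>a a' b b'. \<lbrakk>(a, a') \<in> R; (b, b') \<in> R\<rbrakk> \<Longrightarrow> (f a b, f a' b') \<in> R"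
    and ab: "a \<in> L" "b \<in> L"
  shows "mult (class_group L R f e) (R `` {a}) (R `` {b}) = R `` {f a b}"
proof -
  have "R `` {f a' b'} = R `` {f a b}" if "a' \<in> R `` {a}" "b' \<in> R `` {b}" for a' b'
    using cong[of a a' b b'] that equiv_class_eq[OF R] by blast
  then have "(\<Union>a'\<in>R `` {a}. \<Union>b'\<in>R `` {b}. R `` {f a' b'}) =
      (\<Union>a'\<in>R `` {a}. \<Union>b'\<in>R `` {b}. R `` {f a b})"
    by (intro SUP_cong refl)
  moreover have "R `` {a} \<noteq> {}" "R `` {b} \<noteq> {}"
    using equiv_class_self[OF R] ab by auto
  ultimately show ?thesis
    by (simp add: class_group_def)
qed

lemma group_class_group:
  assumes R: "equiv L R"
    and cong: "\<And>a a' b b'. \<lbrakk>(a, a') \<in> R; (b, b') \<in> R\<rbrakk> \<Longrightarrow> (f a b, f a' b') \<in> R"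
    and e: "e \<in> L"
    and assoc: "\<And>a b c. \<lbrakk>a \<in> L; b \<in> L; c \<in> L\<rbrakk> \<Longrightarrow> (f (f a b) c, f a (f b c)) \<in> R"
    and lunit: "\<And>a. a \<in> L \<Longrightarrow> (f e a, a) \<in> R"
    and linv: "\<And>a. a \<in> L \<Longrightarrow> \<exists>b\<in>L. (f b a, e) \<in> R"
  shows "group (class_group L R f e)"
proof -
  let ?G = "class_group L R f e"
  note mult = class_group_mult[of L R f, OF R cong]
  have eqI: "R `` {a} = R `` {b}" if "(a, b) \<in> R" for a b
    using that equiv_class_eq[OF R] by blast
  have closed: "f a b \<in> L" if "a \<in> L" "b \<in> L" for a b
    using cong[of a a b b] R that by (auto simp: equiv_def refl_on_def)
  have carr: "R `` {a} \<in> carrier ?G" if "a \<in> L" for a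
    using that by (simp add: class_group_def quotientI)
  have rep: "\<exists>a\<in>L. x = R `` {a}" if "x \<in> carrier ?G" for x
    using that by (auto simp: class_group_def elim: quotientE)
  have one: "\<one>\<^bsub>?G\<^esub> = R `` {e}"
    by (simp add: class_group_def)
  show ?thesis
  proof (rule groupI)
    fix x y assume "x \<in> carrier ?G" "y \<in> carrier ?G"
    then obtain a b where "a \<in> L" "x = R `` {a}" "b \<in> L" "y = R `` {b}"
      using rep by blast
    then show "x \<otimes>\<^bsub>?G\<^esub> y \<in> carrier ?G"
      by (simp add: mult closed carr)
  next
    show "\<one>\<^bsub>?G\<^esub> \<in> carrier ?G"
      using carr e one by simp
  next
    fix x y z assume "x \<in> carrier ?G" "y \<in> carrier ?G" "z \<in> carrier ?G"
    then obtain a b c where "a \<in> L" "x = R `` {a}" "b \<in> L" "y = R `` {b}" "c \<in> L" "z = R `` {c}"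
      using rep by metis
    then show "x \<otimes>\<^bsub>?G\<^esub> y \<otimes>\<^bsub>?G\<^esub> z = x \<otimes>\<^bsub>?G\<^esub> (y \<otimes>\<^bsub>?G\<^esub> z)"
      by (simp add: mult closed eqI assoc)
  next
    fix x assume "x \<in> carrier ?G"
    then obtain a where a: "a \<in> L" "x = R `` {a}"
      using rep by blast
    then show "\<one>\<^bsub>?G\<^esub> \<otimes>\<^bsub>?G\<^esub> x = x"
      by (simp add: one mult e eqI lunit)
    obtain b where b: "b \<in> L" "(f b a, e) \<in> R"
      using linv a by blast
    then show "\<exists>y\<in>carrier ?G. y \<otimes>\<^bsub>?G\<^esub> x = \<one>\<^bsub>?G\<^esub>"
      using a by (intro bexI[of _ "R `` {b}"]) (simp_all add: one mult eqI carr)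
  qed
qed


section \<open>Topological fundamental group\<close>

definition loops_at :: "'a::topological_space set \<Rightarrow> 'a \<Rightarrow> (real \<Rightarrow> 'a) set" where
  "loops_at X x0 = {p. path p \<and> path_image p \<subseteq> X \<and> pathstart p = x0 \<and> pathfinish p = x0}"

definition fundamental_group ::
    "'a::topological_space set \<Rightarrow> 'a \<Rightarrow> (real \<Rightarrow> 'a) set monoid" where
  "fundamental_group X x0 =
     class_group (loops_at X x0)
       {(p, q). p \<in> loops_at X x0 \<and> q \<in> loops_at X x0 \<and> homotopic_paths X p q}
       (+++) (\<lambda>_. x0)"

lemma group_fundamental_group:
  fixes X :: "'a::real_normed_vector set"
  assumes "x0 \<in> X"
  shows "group (fundamental_group X x0)"
  unfolding fundamental_group_def
proof (rule group_class_group)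
  let ?R = "{(p, q). p \<in> loops_at X x0 \<and> q \<in> loops_at X x0 \<and> homotopic_paths X p q}"
  show "equiv (loops_at X x0) ?R"
  proof (rule equivI)
    show "trans ?R"
      by (rule transI) (blast intro: homotopic_paths_trans)
  qed (auto simp: refl_on_def sym_def loops_at_def intro: homotopic_paths_sym)
  show "(\<lambda>_. x0) \<in> loops_at X x0"
    using assms by (auto simp: loops_at_def path_def path_image_def pathstart_def pathfinish_def)
  have join: "a +++ b \<in> loops_at X x0" if "a \<in> loops_at X x0" "b \<in> loops_at X x0" for a b
    using that by (simp add: loops_at_def path_image_join)
  show "(a +++ b, a' +++ b') \<in> ?R" if "(a, a') \<in> ?R" "(b, b') \<in> ?R" for a a' b b'
    using that join homotopic_paths_join[of X a a' b b'] by (simp add: loops_at_def)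
  show "((a +++ b) +++ c, a +++ (b +++ c)) \<in> ?R"
    if "a \<in> loops_at X x0" "b \<in> loops_at X x0" "c \<in> loops_at X x0" for a b c
    using that join homotopic_paths_sym[OF homotopic_paths_assoc[of a X b c]]
    by (simp add: loops_at_def)
  show "((\<lambda>_. x0) +++ a, a) \<in> ?R" if "a \<in> loops_at X x0" for a
    using that join[OF \<open>(\<lambda>_. x0) \<in> loops_at X x0\<close> that] homotopic_paths_lid'[of a X x0]
    by (simp add: linepath_refl loops_at_def)
  show "\<exists>b\<in>loops_at X x0. (b +++ a, \<lambda>_. x0) \<in> ?R" if "a \<in> loops_at X x0" for a
  proof
    show *: "reversepath a \<in> loops_at X x0"
      using that by (simp add: loops_at_def)
    show "(reversepath a +++ a, \<lambda>_. x0) \<in> ?R"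
      using that join[OF * that] \<open>(\<lambda>_. x0) \<in> loops_at X x0\<close> homotopic_paths_linv[of a X]
      by (simp add: linepath_refl loops_at_def)
  qed
qed


section \<open>Simplicial complexes\<close>

text \<open>
  Not to be confused with \<^const>\<open>simplicial_complex\<close>, which is about geometric complexes in a
  Euclidean space. The empty set is a simplex of every complex with a vertex.
\<close>

definition abstract_complex :: "'v set \<Rightarrow> 'v set set \<Rightarrow> bool" where
  "abstract_complex V S \<longleftrightarrow>
     (\<forall>\<sigma>\<in>S. finite \<sigma> \<and> \<sigma> \<subseteq> V) \<and> (\<forall>\<sigma>\<in>S. \<forall>\<tau>. \<tau> \<subseteq> \<sigma> \<longrightarrow> \<tau> \<in> S) \<and> (\<forall>v\<in>V. {v} \<in> S)"

definition connected_complex :: "'v set \<Rightarrow> 'v set set \<Rightarrow> bool" where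
  "connected_complex V S \<longleftrightarrow>
     (\<forall>s\<in>V. \<forall>t\<in>V. \<exists>n u. u 0 = s \<and> u n = t \<and> (\<forall>i\<le>n. u i \<in> V) \<and>
        (\<forall>i<n. {u i, u (Suc i)} \<in> S))"

text \<open>
  A point of the realization is given by its barycentric coordinates, a finitely supported function
  on the vertices. The type \<^typ>\<open>'v \<Rightarrow>\<^sub>0 real\<close> carries the topology of the \<open>l\<^sup>1\<close> norm; on the
  realization of a finite complex this induces the usual topology, in which a set is open
  iff its trace on every closed simplex is open there (\<open>openin_geometric_realization\<close> below).
\<close>

definition closed_simplex :: "'v set \<Rightarrow> ('v \<Rightarrow>\<^sub>0 real) set" where
  "closed_simplex \<sigma> =
     {x. Poly_Mapping.keys x \<subseteq> \<sigma> \<and> (\<forall>v. 0 \<le> Poly_Mapping.lookup x v) \<and>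
         (\<Sum>v\<in>Poly_Mapping.keys x. Poly_Mapping.lookup x v) = 1}"

definition geometric_realization :: "'v set set \<Rightarrow> ('v \<Rightarrow>\<^sub>0 real) set" where
  "geometric_realization S = (\<Union>\<sigma>\<in>S. closed_simplex \<sigma>)"

definition Pos :: "'v set set \<Rightarrow> ('v set \<times> 'v set) set" where
  "Pos S = {(\<sigma>, \<tau>). \<sigma> \<in> S \<and> \<tau> \<in> S \<and> \<sigma> \<noteq> {} \<and> \<tau> \<noteq> {} \<and> \<sigma> \<subseteq> \<tau>}"

lemma Field_Pos: "Field (Pos S) = S - {{}}"
  by (auto simp: Field_def Pos_def)

lemma partial_order_on_Pos: "partial_order_on (S - {{}}) (Pos S)"
  by (auto simp: partial_order_on_def preorder_on_def refl_on_def trans_def antisym_def Pos_def)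

lemma continuous_on_lookup: "continuous_on A (\<lambda>x :: 'v \<Rightarrow>\<^sub>0 real. Poly_Mapping.lookup x v)"
proof -
  have "\<bar>Poly_Mapping.lookup x v - Poly_Mapping.lookup y v\<bar> \<le> dist x y" for x y :: "'v \<Rightarrow>\<^sub>0 real"
  proof (cases "v \<in> Poly_Mapping.keys x \<union> Poly_Mapping.keys y")
    case True
    have "dist (Poly_Mapping.lookup x v) (Poly_Mapping.lookup y v) \<le> dist x y"
      unfolding dist_poly_mapping_def
      by (rule member_le_sum[OF True]) auto
    then show ?thesis
      by (simp add: dist_real_def)
  qed (simp add: in_keys_iff)
  then have "1-lipschitz_on A (\<lambda>x :: 'v \<Rightarrow>\<^sub>0 real. Poly_Mapping.lookup x v)"
    by (intro lipschitz_onI) (simp_all add: dist_real_def)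
  then show ?thesis
    by (rule lipschitz_on_continuous_on)
qed

lemma closed_closed_simplex:
  assumes "finite \<sigma>"
  shows "closed (closed_simplex \<sigma>)"
proof -
  have "closed_simplex \<sigma> =
      (\<Inter>v\<in>-\<sigma>. {x. Poly_Mapping.lookup x v = 0}) \<inter> (\<Inter>v. {x. 0 \<le> Poly_Mapping.lookup x v}) \<inter>
      {x. (\<Sum>v\<in>\<sigma>. Poly_Mapping.lookup x v) = 1}"
  proof -
    have "(\<Sum>v\<in>\<sigma>. Poly_Mapping.lookup x v) = (\<Sum>v\<in>Poly_Mapping.keys x. Poly_Mapping.lookup x v)"
      if "Poly_Mapping.keys x \<subseteq> \<sigma>" for x :: "'a \<Rightarrow>\<^sub>0 real"
      using assms that by (intro sum.mono_neutral_right) (auto simp: in_keys_iff)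
    moreover have "Poly_Mapping.keys x \<subseteq> \<sigma> \<longleftrightarrow> (\<forall>v\<in>-\<sigma>. Poly_Mapping.lookup x v = 0)"
      for x :: "'a \<Rightarrow>\<^sub>0 real"
      by (auto simp: in_keys_iff)
    ultimately show ?thesis
      unfolding closed_simplex_def by auto
  qed
  moreover have "closed {x :: 'a \<Rightarrow>\<^sub>0 real. Poly_Mapping.lookup x v = 0}" for v
    by (intro closed_Collect_eq continuous_on_lookup continuous_intros)
  moreover have "closed {x :: 'a \<Rightarrow>\<^sub>0 real. 0 \<le> Poly_Mapping.lookup x v}" for v
    by (intro closed_Collect_le continuous_on_lookup continuous_intros)
  moreover have "closed {x :: 'a \<Rightarrow>\<^sub>0 real. (\<Sum>v\<in>\<sigma>. Poly_Mapping.lookup x v) = 1}"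
    by (intro closed_Collect_eq continuous_on_lookup continuous_intros)
  ultimately show ?thesis
    by (simp add: closed_INT closed_Int)
qed

lemma openin_geometric_realization:
  assumes "abstract_complex V S" "finite V" "U \<subseteq> geometric_realization S"
  shows "openin (top_of_set (geometric_realization S)) U \<longleftrightarrow>
         (\<forall>\<sigma>\<in>S. openin (top_of_set (closed_simplex \<sigma>)) (U \<inter> closed_simplex \<sigma>))"
proof
  assume "openin (top_of_set (geometric_realization S)) U"
  then obtain T where T: "open T" "U = geometric_realization S \<inter> T"
    by (auto simp: openin_open)
  have "U \<inter> closed_simplex \<sigma> = closed_simplex \<sigma> \<inter> T" if "\<sigma> \<in> S" for \<sigma>
    using that T by (auto simp: geometric_realization_def)
  then show "\<forall>\<sigma>\<in>S. openin (top_of_set (closed_simplex \<sigma>)) (U \<inter> closed_simplex \<sigma>)"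
    using T by auto
next
  assume *: "\<forall>\<sigma>\<in>S. openin (top_of_set (closed_simplex \<sigma>)) (U \<inter> closed_simplex \<sigma>)"
  have S: "finite S" "\<And>\<sigma>. \<sigma> \<in> S \<Longrightarrow> finite \<sigma>"
    using assms finite_subset[of S "Pow V"] by (auto simp: abstract_complex_def)
  have "closed (closed_simplex \<sigma> - U)" if "\<sigma> \<in> S" for \<sigma>
  proof -
    have "closedin (top_of_set (closed_simplex \<sigma>)) (closed_simplex \<sigma> - U)"
      using * that by (auto simp: closedin_def Diff_Diff_Int Int_commute)
    then show ?thesis
      using closed_closed_simplex S that closedin_closed_trans by blast
  qed
  then have "closed (\<Union>\<sigma>\<in>S. closed_simplex \<sigma> - U)"
    using S by (intro closed_UN) auto
  moreover have "U = geometric_realization S - (\<Union>\<sigma>\<in>S. closed_simplex \<sigma> - U)"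
    using assms(3) by (auto simp: geometric_realization_def)
  ultimately show "openin (top_of_set (geometric_realization S)) U"
    by (metis Diff_eq open_Compl openin_open_Int)
qed


section \<open>Path algebras of quivers\<close>

text \<open>
  A quiver is a \<^typ>\<open>('a, 'b) pre_digraph\<close>. A path is a triple of its beginning, its list of arrows
  in the order of traversal, and its end; the product \<open>p \<cdot> q\<close> traverses \<open>q\<close> first.
\<close>

type_synonym ('a, 'b) qpath = "'a \<times> 'b list \<times> 'a"

definition paths :: "('a, 'b) pre_digraph \<Rightarrow> ('a, 'b) qpath set" where
  "paths Q = {(x, p, y). pre_digraph.awalk Q x p y}"

fun composable :: "('a, 'b) qpath \<Rightarrow> ('a, 'b) qpath \<Rightarrow> bool" where
  "composable (x, p, y) (x', p', y') \<longleftrightarrow> y' = x"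

fun comp_path :: "('a, 'b) qpath \<Rightarrow> ('a, 'b) qpath \<Rightarrow> ('a, 'b) qpath" where
  "comp_path (x, p, y) (x', p', y') = (x', p' @ p, y)"

fun parallel :: "('a, 'b) qpath \<Rightarrow> ('a, 'b) qpath \<Rightarrow> bool" where
  "parallel (x, p, y) (x', p', y') \<longleftrightarrow> x = x' \<and> y = y'"

definition path_mult ::
    "(('a, 'b) qpath \<Rightarrow>\<^sub>0 'k::field) \<Rightarrow> (('a, 'b) qpath \<Rightarrow>\<^sub>0 'k) \<Rightarrow> (('a, 'b) qpath \<Rightarrow>\<^sub>0 'k)" where
  "path_mult f g =
     (\<Sum>p\<in>Poly_Mapping.keys f. \<Sum>q\<in>Poly_Mapping.keys g.
        if composable p q
        then Poly_Mapping.single (comp_path p q) (Poly_Mapping.lookup f p * Poly_Mapping.lookup g q)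
        else 0)"

text \<open>The unit is meaningful only for quivers with finitely many vertices.\<close>

definition path_algebra :: "('a, 'b) pre_digraph \<Rightarrow> (('a, 'b) qpath \<Rightarrow>\<^sub>0 'k::field) ring" where
  "path_algebra Q =
     \<lparr>carrier = {f. Poly_Mapping.keys f \<subseteq> paths Q}, mult = path_mult,
      one = (\<Sum>x\<in>verts Q. Poly_Mapping.single (x, [], x) 1), zero = 0, add = (+)\<rparr>"

definition parallel_ideal :: "('a, 'b) pre_digraph \<Rightarrow> (('a, 'b) qpath \<Rightarrow>\<^sub>0 'k::field) set" where
  "parallel_ideal Q =
     Idl\<^bsub>path_algebra Q\<^esub> {Poly_Mapping.single p 1 - Poly_Mapping.single q 1 | p q.
        p \<in> paths Q \<and> q \<in> paths Q \<and> parallel p q}"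

lemma path_mult_superset:
  assumes "finite A" "finite B" "Poly_Mapping.keys f \<subseteq> A" "Poly_Mapping.keys g \<subseteq> B"
  shows "path_mult f g =
     (\<Sum>p\<in>A. \<Sum>q\<in>B. if composable p q
        then Poly_Mapping.single (comp_path p q) (Poly_Mapping.lookup f p * Poly_Mapping.lookup g q)
        else 0)"
proof -
  have "path_mult f g =
     (\<Sum>p\<in>Poly_Mapping.keys f. \<Sum>q\<in>B. if composable p q
        then Poly_Mapping.single (comp_path p q) (Poly_Mapping.lookup f p * Poly_Mapping.lookup g q)
        else 0)"
    unfolding path_mult_def using assms
    by (intro sum.cong refl sum.mono_neutral_left) (auto simp: in_keys_iff)
  also have "\<dots> = (\<Sum>p\<in>A. \<Sum>q\<in>B. if composable p q
        then Poly_Mapping.single (comp_path p q) (Poly_Mapping.lookup f p * Poly_Mapping.lookup g q)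
        else 0)"
    using assms by (intro sum.mono_neutral_left) (auto simp: in_keys_iff intro!: sum.neutral)
  finally show ?thesis .
qed

lemma path_mult_add_left: "path_mult (f + g) h = path_mult f h + path_mult g h"
proof -
  let ?A = "Poly_Mapping.keys f \<union> Poly_Mapping.keys g" and ?B = "Poly_Mapping.keys h"
  let ?t = "\<lambda>f p q. if composable p q
    then Poly_Mapping.single (comp_path p q) (Poly_Mapping.lookup f p * Poly_Mapping.lookup h q) else 0"
  have *: "path_mult f' h = (\<Sum>p\<in>?A. \<Sum>q\<in>?B. ?t f' p q)" if "Poly_Mapping.keys f' \<subseteq> ?A" for f'
    using that by (intro path_mult_superset) simp_all
  have "?t (f + g) p q = ?t f p q + ?t g p q" for p q
    by (simp add: Poly_Mapping.lookup_add distrib_right Poly_Mapping.single_add)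
  then show ?thesis
    by (simp only: *[OF Poly_Mapping.keys_add] *[OF Un_upper1] *[OF Un_upper2] sum.distrib)
qed

lemma path_mult_add_right: "path_mult h (f + g) = path_mult h f + path_mult h g"
proof -
  let ?A = "Poly_Mapping.keys f \<union> Poly_Mapping.keys g" and ?B = "Poly_Mapping.keys h"
  let ?t = "\<lambda>f p q. if composable p q
    then Poly_Mapping.single (comp_path p q) (Poly_Mapping.lookup h p * Poly_Mapping.lookup f q) else 0"
  have *: "path_mult h f' = (\<Sum>p\<in>?B. \<Sum>q\<in>?A. ?t f' p q)" if "Poly_Mapping.keys f' \<subseteq> ?A" for f'
    using that by (intro path_mult_superset) simp_all
  have "?t (f + g) p q = ?t f p q + ?t g p q" for p q
    by (simp add: Poly_Mapping.lookup_add distrib_left Poly_Mapping.single_add)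
  then show ?thesis
    by (simp only: *[OF Poly_Mapping.keys_add] *[OF Un_upper1] *[OF Un_upper2] sum.distrib)
qed

lemma path_mult_0 [simp]: "path_mult 0 f = 0" "path_mult f 0 = 0"
  by (simp_all add: path_mult_def)

lemma path_mult_single:
  "path_mult (Poly_Mapping.single p a) (Poly_Mapping.single q b) =
     (if composable p q then Poly_Mapping.single (comp_path p q) (a * b) else 0)"
  by (subst path_mult_superset[of "{p}" "{q}"]) auto

lemma poly_mapping_single_induct:
  fixes f :: "'a \<Rightarrow>\<^sub>0 'k::field"
  assumes "P 0" "\<And>p a. p \<in> Poly_Mapping.keys f \<Longrightarrow> P (Poly_Mapping.single p a)"
    "\<And>f g. P f \<Longrightarrow> P g \<Longrightarrow> P (f + g)"
  shows "P f"
proof -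
  have "P (\<Sum>p\<in>A. Poly_Mapping.single p (Poly_Mapping.lookup f p))"
    if "finite A" "A \<subseteq> Poly_Mapping.keys f" for A
    using that by (induction A) (auto intro: assms)
  from this[OF finite_keys order_refl]
  have "P (\<Sum>p\<in>Poly_Mapping.keys f. Poly_Mapping.single p (Poly_Mapping.lookup f p))" .
  moreover have "(\<Sum>p\<in>Poly_Mapping.keys f. Poly_Mapping.single p (Poly_Mapping.lookup f p)) = f"
    by (rule poly_mapping_eqI)
      (simp add: Poly_Mapping.lookup_sum Poly_Mapping.lookup_single when_def in_keys_iff)
  ultimately show ?thesis
    by simp
qed

lemma path_mult_assoc: "path_mult (path_mult f g) h = path_mult f (path_mult g h)"
proof (induction f rule: poly_mapping_single_induct)
  case (2 p a)
  show ?case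
  proof (induction g rule: poly_mapping_single_induct)
    case (2 q b)
    show ?case
    proof (induction h rule: poly_mapping_single_induct)
      case (2 r c)
      show ?case
        by (cases p; cases q; cases r) (auto simp: path_mult_single mult.assoc)
    qed (simp_all add: path_mult_add_right)
  qed (simp_all add: path_mult_add_left path_mult_add_right)
qed (simp_all add: path_mult_add_left)

lemma comp_path_in_paths:
  assumes "wf_digraph Q" "p \<in> paths Q" "q \<in> paths Q" "composable p q"
  shows "comp_path p q \<in> paths Q"
  using assms wf_digraph.awalk_appendI[OF assms(1)]
  by (cases p; cases q) (auto simp: paths_def)

lemma ring_path_algebra:
  assumes wf: "wf_digraph Q" and fin: "finite (verts Q)"
  shows "ring (path_algebra Q :: (('a, 'b) qpath \<Rightarrow>\<^sub>0 'k::field) ring)"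
proof (rule ringI)
  let ?R = "path_algebra Q :: (('a, 'b) qpath \<Rightarrow>\<^sub>0 'k::field) ring"
  have trivial: "(x, [], x) \<in> paths Q" if "x \<in> verts Q" for x
    using that by (simp add: paths_def pre_digraph.awalk_def pre_digraph.cas.simps)
  have ends: "x \<in> verts Q \<and> y \<in> verts Q" if "(x, p, y) \<in> paths Q" for x p y
    using that wf_digraph.awalk_last_in_verts[OF wf] wf_digraph.awalk_hd_in_verts[OF wf]
    by (auto simp: paths_def)
  have sum_keys: "Poly_Mapping.keys (\<Sum>i\<in>A. g i) \<subseteq> T"
    if "\<And>i. i \<in> A \<Longrightarrow> Poly_Mapping.keys (g i) \<subseteq> T"
    for A :: "'i set" and g :: "'i \<Rightarrow> ('a, 'b) qpath \<Rightarrow>\<^sub>0 'k" and T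
    using that Poly_Mapping.keys_sum[of g A] by blast
  show "abelian_group ?R"
  proof (rule abelian_groupI)
    fix f assume "f \<in> carrier ?R"
    then show "\<exists>g\<in>carrier ?R. g \<oplus>\<^bsub>?R\<^esub> f = \<zero>\<^bsub>?R\<^esub>"
      by (intro bexI[of _ "- f"]) (simp_all add: path_algebra_def)
  next
    fix f g assume "f \<in> carrier ?R" "g \<in> carrier ?R"
    then show "f \<oplus>\<^bsub>?R\<^esub> g \<in> carrier ?R"
      using Poly_Mapping.keys_add[of f g] by (auto simp: path_algebra_def)
  qed (simp_all add: path_algebra_def add_ac)
  show "Group.monoid ?R"
  proof (rule Group.monoidI)
    fix f g assume fg: "f \<in> carrier ?R" "g \<in> carrier ?R"
    have "Poly_Mapping.keys (if composable p q then Poly_Mapping.single (comp_path p q)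
        (Poly_Mapping.lookup f p * Poly_Mapping.lookup g q) else 0) \<subseteq> paths Q"
      if "p \<in> Poly_Mapping.keys f" "q \<in> Poly_Mapping.keys g" for p q
      using that fg comp_path_in_paths[OF wf, of p q] by (auto simp: path_algebra_def)
    then have "Poly_Mapping.keys (path_mult f g) \<subseteq> paths Q"
      unfolding path_mult_def by (intro sum_keys)
    then show "f \<otimes>\<^bsub>?R\<^esub> g \<in> carrier ?R"
      by (simp add: path_algebra_def)
  next
    show "\<one>\<^bsub>?R\<^esub> \<in> carrier ?R"
      using trivial sum_keys[of "verts Q" "\<lambda>x. Poly_Mapping.single (x, [], x) 1" "paths Q"]
      by (simp add: path_algebra_def)
  next
    fix f g h
    show "f \<otimes>\<^bsub>?R\<^esub> g \<otimes>\<^bsub>?R\<^esub> h = f \<otimes>\<^bsub>?R\<^esub> (g \<otimes>\<^bsub>?R\<^esub> h)"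
      by (simp add: path_algebra_def path_mult_assoc)
  next
    have suml: "path_mult (\<Sum>x\<in>A. F x) f = (\<Sum>x\<in>A. path_mult (F x) f)"
      for A and F :: "'a \<Rightarrow> ('a, 'b) qpath \<Rightarrow>\<^sub>0 'k" and f
      by (induction A rule: infinite_finite_induct) (simp_all add: path_mult_add_left)
    have sumr: "path_mult f (\<Sum>x\<in>A. F x) = (\<Sum>x\<in>A. path_mult f (F x))"
      for A and F :: "'a \<Rightarrow> ('a, 'b) qpath \<Rightarrow>\<^sub>0 'k" and f
      by (induction A rule: infinite_finite_induct) (simp_all add: path_mult_add_right)
    fix f assume f: "f \<in> carrier ?R"
    have "path_mult (\<Sum>x\<in>verts Q. Poly_Mapping.single (x, [], x) 1) f = f"
    proof (induction f rule: poly_mapping_single_induct)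
      case (2 p a)
      obtain x w y where p: "p = (x, w, y)"
        by (cases p)
      have "y \<in> verts Q"
        using ends f 2 p by (auto simp: path_algebra_def)
      then show ?case
        using fin by (simp add: suml path_mult_single p cong: if_cong)
    qed (simp_all add: path_mult_add_right)
    then show "\<one>\<^bsub>?R\<^esub> \<otimes>\<^bsub>?R\<^esub> f = f"
      by (simp add: path_algebra_def)
    have "path_mult f (\<Sum>x\<in>verts Q. Poly_Mapping.single (x, [], x) 1) = f"
    proof (induction f rule: poly_mapping_single_induct)
      case (2 p a)
      obtain x w y where p: "p = (x, w, y)"
        by (cases p)
      have "x \<in> verts Q"
        using ends f 2 p by (auto simp: path_algebra_def)
      then show ?case
        using fin by (simp add: sumr path_mult_single p cong: if_cong)
    qed (simp_all add: path_mult_add_left)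
    then show "f \<otimes>\<^bsub>?R\<^esub> \<one>\<^bsub>?R\<^esub> = f"
      by (simp add: path_algebra_def)
  qed
qed (simp_all add: path_algebra_def path_mult_add_left path_mult_add_right)

lemma ideal_parallel_ideal:
  assumes "wf_digraph Q" "finite (verts Q)"
  shows "ideal (parallel_ideal Q :: (('a, 'b) qpath \<Rightarrow>\<^sub>0 'k::field) set) (path_algebra Q)"
  unfolding parallel_ideal_def
proof (rule ring.genideal_ideal[OF ring_path_algebra[OF assms]])
  have "Poly_Mapping.keys (Poly_Mapping.single p 1 - Poly_Mapping.single q (1::'k)) \<subseteq> paths Q"
    if "p \<in> paths Q" "q \<in> paths Q" for p q
    using that by (auto simp: in_keys_iff Poly_Mapping.lookup_minus Poly_Mapping.lookup_single when_def split: if_splits)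
  then show "{Poly_Mapping.single p 1 - Poly_Mapping.single q 1 | p q.
        p \<in> paths Q \<and> q \<in> paths Q \<and> parallel p q}
      \<subseteq> carrier (path_algebra Q :: (('a, 'b) qpath \<Rightarrow>\<^sub>0 'k) ring)"
    unfolding path_algebra_def by force
qed


section \<open>Algebraic fundamental group\<close>

text \<open>
  The sum of the \<open>\<lambda>\<^sub>i \<omega>\<^sub>i\<close> with nonzero \<open>\<lambda>\<^sub>i\<close> and distinct \<open>\<omega>\<^sub>i\<close> is the element \<open>f\<close> of the path algebra
  with support the \<open>\<omega>\<^sub>i\<close> and coefficients the \<open>\<lambda>\<^sub>i\<close>.
\<close>

definition minimal_relation ::
    "(('a, 'b) qpath \<Rightarrow>\<^sub>0 'k::field) set \<Rightarrow> (('a, 'b) qpath \<Rightarrow>\<^sub>0 'k) \<Rightarrow> bool" where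
  "minimal_relation I f \<longleftrightarrow> f \<in> I \<and>
     (\<forall>J. J \<noteq> {} \<and> J \<subset> Poly_Mapping.keys f \<longrightarrow>
        (\<Sum>p\<in>J. Poly_Mapping.single p (Poly_Mapping.lookup f p)) \<notin> I)"

text \<open>
  Walks of \<open>Q\<close> are the paths of the quiver obtained by adding to every arrow \<open>a\<close>, here \<open>Inl a\<close>,
  a formal inverse \<open>Inr a\<close>.
\<close>

definition double_quiver :: "('a, 'b) pre_digraph \<Rightarrow> ('a, 'b + 'b) pre_digraph" where
  "double_quiver Q =
     \<lparr>verts = verts Q, arcs = arcs Q <+> arcs Q,
      tail = case_sum (tail Q) (head Q), head = case_sum (head Q) (tail Q)\<rparr>"

definition walks :: "('a, 'b) pre_digraph \<Rightarrow> ('a, 'b + 'b) qpath set" where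
  "walks Q = paths (double_quiver Q)"

fun walk_of_path :: "('a, 'b) qpath \<Rightarrow> ('a, 'b + 'b) qpath" where
  "walk_of_path (x, p, y) = (x, map Inl p, y)"

inductive walk_equiv ::
    "('a, 'b) pre_digraph \<Rightarrow> (('a, 'b) qpath \<Rightarrow>\<^sub>0 'k::field) set \<Rightarrow>
     ('a, 'b + 'b) qpath \<Rightarrow> ('a, 'b + 'b) qpath \<Rightarrow> bool"
  for Q I where
  refl: "w \<in> walks Q \<Longrightarrow> walk_equiv Q I w w"
| sym: "walk_equiv Q I w w' \<Longrightarrow> walk_equiv Q I w' w"
| trans: "walk_equiv Q I w w' \<Longrightarrow> walk_equiv Q I w' w'' \<Longrightarrow> walk_equiv Q I w w''"
| arrow_inverse: "a \<in> arcs Q \<Longrightarrow>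
    walk_equiv Q I (head Q a, [Inr a, Inl a], head Q a) (head Q a, [], head Q a)"
| inverse_arrow: "a \<in> arcs Q \<Longrightarrow>
    walk_equiv Q I (tail Q a, [Inl a, Inr a], tail Q a) (tail Q a, [], tail Q a)"
| relation: "minimal_relation I f \<Longrightarrow> p \<in> Poly_Mapping.keys f \<Longrightarrow> q \<in> Poly_Mapping.keys f \<Longrightarrow>
    walk_equiv Q I (walk_of_path p) (walk_of_path q)"
| congruence: "walk_equiv Q I w w' \<Longrightarrow> u \<in> walks Q \<Longrightarrow> v \<in> walks Q \<Longrightarrow>
    composable u w \<Longrightarrow> composable w v \<Longrightarrow> composable u w' \<Longrightarrow> composable w' v \<Longrightarrow>
    walk_equiv Q I (comp_path (comp_path u w) v) (comp_path (comp_path u w') v)"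

definition walk_loops :: "('a, 'b) pre_digraph \<Rightarrow> 'a \<Rightarrow> ('a, 'b + 'b) qpath set" where
  "walk_loops Q x = {w \<in> walks Q. \<exists>p. w = (x, p, x)}"

definition algebraic_fundamental_group ::
    "('a, 'b) pre_digraph \<Rightarrow> (('a, 'b) qpath \<Rightarrow>\<^sub>0 'k::field) set \<Rightarrow> 'a \<Rightarrow>
     ('a, 'b + 'b) qpath set monoid" where
  "algebraic_fundamental_group Q I x =
     class_group (walk_loops Q x)
       {(w, w'). w \<in> walk_loops Q x \<and> w' \<in> walk_loops Q x \<and> walk_equiv Q I w w'}
       comp_path (x, [], x)"

lemma wf_digraph_double_quiver: "wf_digraph Q \<Longrightarrow> wf_digraph (double_quiver Q)"
  by unfold_locales
    (auto simp: double_quiver_def wf_digraph.tail_in_verts wf_digraph.head_in_verts)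

lemma walk_equiv_inverse:
  assumes wf: "wf_digraph Q" and walk: "(x, p, y) \<in> walks Q"
  shows "(y, rev (map (case_sum Inr Inl) p), x) \<in> walks Q \<and>
         walk_equiv Q I (x, p @ rev (map (case_sum Inr Inl) p), x) (x, [], x)"
  using walk
proof (induction p arbitrary: x)
  case Nil
  then show ?case
    by (auto simp: walks_def paths_def pre_digraph.awalk_def pre_digraph.cas.simps
        intro!: walk_equiv.refl)
next
  case (Cons a p)
  let ?D = "double_quiver Q" and ?i = "case_sum Inr Inl :: 'b + 'b \<Rightarrow> 'b + 'b"
  interpret D: wf_digraph ?D
    by (rule wf_digraph_double_quiver[OF wf])
  have a: "a \<in> arcs ?D" "tail ?D a = x" and p: "(head ?D a, p, y) \<in> walks Q"
    using Cons.prems by (auto simp: walks_def paths_def D.awalk_Cons_iff)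
  have ia: "?i a \<in> arcs ?D" "tail ?D (?i a) = head ?D a" "head ?D (?i a) = x"
    using a by (auto simp: double_quiver_def split: sum.splits)
  have arrows: "(x, [a], head ?D a) \<in> walks Q" "(head ?D a, [?i a], x) \<in> walks Q"
    using a ia D.tail_in_verts[OF a(1)] D.head_in_verts[OF a(1)]
    by (auto simp: walks_def paths_def D.awalk_Cons_iff D.awalk_Nil_iff)
  note IH = Cons.IH[OF p]
  have "(y, rev (map ?i p) @ [?i a], x) \<in> walks Q"
    using IH arrows D.awalk_appendI by (auto simp: walks_def paths_def)
  moreover have "walk_equiv Q I (x, a # p @ rev (map ?i p) @ [?i a], x) (x, [a, ?i a], x)"
    using walk_equiv.congruence[OF conjunct2[OF IH] arrows(2,1)] by simp
  moreover have "walk_equiv Q I (x, [a, ?i a], x) (x, [], x)"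
    using a walk_equiv.arrow_inverse[of _ Q I] walk_equiv.inverse_arrow[of _ Q I]
    by (auto simp: double_quiver_def)
  ultimately show ?case
    by (auto intro: walk_equiv.trans)
qed

lemma group_algebraic_fundamental_group:
  assumes wf: "wf_digraph Q" and x: "x \<in> verts Q"
  shows "group (algebraic_fundamental_group Q I x)"
  unfolding algebraic_fundamental_group_def
proof (rule group_class_group)
  interpret D: wf_digraph "double_quiver Q"
    by (rule wf_digraph_double_quiver[OF wf])
  let ?L = "walk_loops Q x"
  let ?R = "{(w, w'). w \<in> ?L \<and> w' \<in> ?L \<and> walk_equiv Q I w w'}"
  show "equiv ?L ?R"
  proof (rule equivI)
    show "trans ?R"
      by (rule transI) (blast intro: walk_equiv.trans)
  qed (auto simp: refl_on_def sym_def walk_loops_def intro: walk_equiv.refl walk_equiv.sym)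
  show one: "(x, [], x) \<in> ?L"
  proof -
    have "x \<in> verts (double_quiver Q)"
      using x by (simp add: double_quiver_def)
    then show ?thesis
      by (simp add: walk_loops_def walks_def paths_def D.awalk_Nil_iff)
  qed
  have comp: "comp_path a b \<in> ?L" if "a \<in> ?L" "b \<in> ?L" for a b
    using that D.awalk_appendI by (auto simp: walk_loops_def walks_def paths_def)
  show "(comp_path a b, comp_path a' b') \<in> ?R" if "(a, a') \<in> ?R" "(b, b') \<in> ?R" for a a' b b'
  proof -
    from that obtain p p' q q' where
      [simp]: "a = (x, p, x)" "a' = (x, p', x)" "b = (x, q, x)" "b' = (x, q', x)"
      by (auto simp: walk_loops_def)
    have w: "walk_equiv Q I (x, p, x) (x, p', x)" "walk_equiv Q I (x, q, x) (x, q', x)"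
      "(x, [], x) \<in> walks Q" "(x, q, x) \<in> walks Q" "(x, p', x) \<in> walks Q"
      using that one by (auto simp: walk_loops_def)
    have "walk_equiv Q I (comp_path a b) (comp_path a' b)"
      using walk_equiv.congruence[OF w(1) w(3) w(4)] by simp
    moreover have "walk_equiv Q I (comp_path a' b) (comp_path a' b')"
      using walk_equiv.congruence[OF w(2) w(5) w(3)] by simp
    ultimately have "walk_equiv Q I (comp_path a b) (comp_path a' b')"
      by (rule walk_equiv.trans)
    then show ?thesis
      using that comp by blast
  qed
  show "(comp_path (comp_path a b) c, comp_path a (comp_path b c)) \<in> ?R"
    if "a \<in> ?L" "b \<in> ?L" "c \<in> ?L" for a b c
  proof -
    have "comp_path (comp_path a b) c = comp_path a (comp_path b c)"
      by (cases a; cases b; cases c) simp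
    then show ?thesis
      using comp[OF that(1) comp[OF that(2,3)]]
      by (auto simp: walk_loops_def intro: walk_equiv.refl)
  qed
  show "(comp_path (x, [], x) a, a) \<in> ?R" if "a \<in> ?L" for a
    using that by (auto simp: walk_loops_def intro: walk_equiv.refl)
  show "\<exists>b\<in>?L. (comp_path b a, (x, [], x)) \<in> ?R" if "a \<in> ?L" for a
  proof -
    from that obtain p where a: "a = (x, p, x)" "(x, p, x) \<in> walks Q"
      by (auto simp: walk_loops_def)
    note inv = walk_equiv_inverse[OF wf a(2), of I]
    then have b: "(x, rev (map (case_sum Inr Inl) p), x) \<in> ?L"
      by (simp add: walk_loops_def)
    with inv comp[OF b that] one show ?thesis
      by (intro bexI[OF _ b]) (simp add: a(1))
  qed
qed

text \<open>A poset is given by its order relation \<open>r\<close>, with carrier \<^term>\<open>Field r\<close>.\<close>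

definition ordered_quiver :: "('a \<times> 'a) set \<Rightarrow> ('a, 'a \<times> 'a) pre_digraph" where
  "ordered_quiver r =
     \<lparr>verts = Field r,
      arcs = {(a, b) \<in> r. a \<noteq> b \<and> \<not> (\<exists>c. c \<noteq> a \<and> c \<noteq> b \<and> (a, c) \<in> r \<and> (c, b) \<in> r)},
      tail = fst, head = snd\<rparr>"

definition poset_fundamental_group ::
    "'k::field itself \<Rightarrow> ('a \<times> 'a) set \<Rightarrow> 'a \<Rightarrow> ('a, 'a \<times> 'a + 'a \<times> 'a) qpath set monoid" where
  "poset_fundamental_group k r x =
     algebraic_fundamental_group (ordered_quiver r)
       (parallel_ideal (ordered_quiver r) :: (('a, 'a \<times> 'a) qpath \<Rightarrow>\<^sub>0 'k) set) x"

lemma wf_digraph_ordered_quiver: "wf_digraph (ordered_quiver r)"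
  by unfold_locales (auto simp: ordered_quiver_def Field_def)

end

theory Submission
  imports Defs
begin

text \<open>
  Send a loop in the realization to the sequence of the carriers of its points at a subdivision so fine
  that every piece stays in the open star of a vertex. Consecutive carriers intersect, and going down to
  the intersection and up again turns the sequence into a walk of the quiver, in which any two upward
  paths with the same ends are equivalent because their difference lies in the parallel ideal. Carriers
  with a common vertex give composable pieces up to equivalence, so refining the subdivision, or moving
  across the cells of a sufficiently fine grid of a homotopy, does not change the class of the walk.
  Conversely a walk is realized by the polygon through the barycenters; equivalent walks give homotopic
  polygons since parallel paths stay in one closed simplex, and a path is homotopic to the polygon of its
  walk since stars are starlike.

  Products of walks are composed from right to left but paths from left to right, so the isomorphism
  sends a loop to the reverse of its walk.
\<close>

section \<open>The parallel ideal\<close>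

text \<open>The carrier of a point is already a vertex of the quiver, so no simplicial approximation
  is needed. The obstacle is choice: the walk depends on the subdivision and on the upward paths
  chosen, so statements about it hold modulo equivalence. What controls this is a vertex common to
  all simplexes involved, through which the transports factor. It comes from a lower bound: every
  point has a barycentric coordinate of at least \<open>1 / card V\<close>, which cannot vanish
  nearby, and uniform continuity yields one mesh for a whole homotopy.

  On the algebraic side, the clause on minimal relations must be shown to identify exactly the
  parallel paths. Coefficient sums over all paths with given ends vanish on the ideal, so it
  contains no nonzero multiple of a single path, and the difference of two distinct parallel paths
  is a minimal relation. Conversely, multiplying by trivial paths splits off the part of a relation
  with given ends, so a minimal relation has only parallel terms.

  Both base points are arbitrary, hence the isomorphism also conjugates by a walk.\<close>

definition hom_sum :: "'a \<Rightarrow> 'a \<Rightarrow> (('a, 'b) qpath \<Rightarrow>\<^sub>0 'k::field) \<Rightarrow> 'k" where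
  "hom_sum x y f = (\<Sum>p\<in>Poly_Mapping.keys f. if fst p = x \<and> snd (snd p) = y then Poly_Mapping.lookup f p else 0)"

lemma hom_sum_superset:
  assumes "finite A" "Poly_Mapping.keys f \<subseteq> A"
  shows "hom_sum x y f = (\<Sum>p\<in>A. if fst p = x \<and> snd (snd p) = y then Poly_Mapping.lookup f p else 0)"
  unfolding hom_sum_def using assms
  by (intro sum.mono_neutral_left) (auto simp: in_keys_iff)

lemma hom_sum_0 [simp]: "hom_sum x y 0 = 0"
  by (simp add: hom_sum_def)

lemma hom_sum_single [simp]:
  "hom_sum x y (Poly_Mapping.single p a) = (if fst p = x \<and> snd (snd p) = y then a else 0)"
  by (subst hom_sum_superset[of "{p}"]) auto

lemma hom_sum_add [simp]: "hom_sum x y (f + g) = hom_sum x y f + hom_sum x y g"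
proof -
  let ?A = "Poly_Mapping.keys f \<union> Poly_Mapping.keys g"
  have *: "hom_sum x y h = (\<Sum>p\<in>?A. if fst p = x \<and> snd (snd p) = y then Poly_Mapping.lookup h p else 0)"
    if "Poly_Mapping.keys h \<subseteq> ?A" for h
    using that by (intro hom_sum_superset) simp_all
  show ?thesis
    by (simp only: *[OF Poly_Mapping.keys_add] *[OF Un_upper1] *[OF Un_upper2]
        sum.distrib[symmetric] Poly_Mapping.lookup_add)
      (simp add: if_distrib cong: if_cong sum.cong)
qed

lemma hom_sum_uminus [simp]: "hom_sum x y (- f) = - hom_sum x y f"
  using hom_sum_add[of x y f "- f"] by (simp add: eq_neg_iff_add_eq_0 add.commute)

lemma hom_sum_diff [simp]: "hom_sum x y (f - g) = hom_sum x y f - hom_sum x y g"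
  using hom_sum_add[of x y f "- g"] by simp

text \<open>The right factor is traversed first, so \<open>p\<close> on the left prolongs the paths
  that end where \<open>p\<close> begins and annihilates the others. Beginnings are kept and
  coefficients are scaled by \<open>a\<close>, so the sums merely move from one pair of ends to
  another.\<close>

lemma hom_sum_single_left:
  "hom_sum x y (path_mult (Poly_Mapping.single p a) f) =
     (if snd (snd p) = y then a * hom_sum x (fst p) f else 0)"
proof (induction f rule: poly_mapping_single_induct)
  case (2 q b)
  then show ?case
    by (cases p; cases q) (auto simp: path_mult_single)
qed (simp_all add: path_mult_add_right distrib_left)

lemma hom_sum_single_right:
  "hom_sum x y (path_mult f (Poly_Mapping.single p a)) =
     (if fst p = x then hom_sum (snd (snd p)) y f * a else 0)"
proof (induction f rule: poly_mapping_single_induct)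
  case (2 q b)
  then show ?case
    by (cases p; cases q) (auto simp: path_mult_single)
qed (simp_all add: path_mult_add_left distrib_right)

text \<open>This and its mirror image make the common kernel of all \<open>hom_sum x y\<close> a
  two-sided ideal. By additivity in \<open>g\<close> it is enough to multiply by one path.\<close>

lemma hom_sum_path_mult_left:
  "(\<And>x y. hom_sum x y f = 0) \<Longrightarrow> hom_sum x y (path_mult g f) = 0"
  by (induction g rule: poly_mapping_single_induct)
    (auto simp: path_mult_add_left hom_sum_single_left)

lemma hom_sum_path_mult_right:
  "(\<And>x y. hom_sum x y f = 0) \<Longrightarrow> hom_sum x y (path_mult f g) = 0"
  by (induction g rule: poly_mapping_single_induct)
    (auto simp: path_mult_add_right hom_sum_single_right)

text \<open>The ideal is a parameter tied down by an equation because its type carries the field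
  \<open>'k\<close>, which the quiver does not determine.\<close>

locale finite_quiver = wf_digraph Q for Q :: "('a, 'b) pre_digraph" +
  fixes I :: "(('a, 'b) qpath \<Rightarrow>\<^sub>0 'k::field) set"
  assumes finite_verts: "finite (verts Q)"
    and I_eq: "I = parallel_ideal Q"
begin

abbreviation R :: "(('a, 'b) qpath \<Rightarrow>\<^sub>0 'k) ring" where "R \<equiv> path_algebra Q"

lemma ring_R: "ring R"
  using ring_path_algebra[OF wf_digraph_axioms finite_verts] .

lemma ideal_I: "ideal I R"
  using ideal_parallel_ideal[OF wf_digraph_axioms finite_verts] by (simp add: I_eq)

lemma keys_in_ideal:
  assumes "f \<in> I"
  shows "Poly_Mapping.keys f \<subseteq> paths Q"
  using ideal.Icarr[OF ideal_I assms] by (simp add: path_algebra_def)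

text \<open>Parallel paths count for the same pair of ends, so their coefficients cancel in each
  generator. The common kernel is an ideal, hence it contains the ideal generated.\<close>

lemma hom_sum_in_ideal:
  assumes "f \<in> I"
  shows "hom_sum x y f = 0"
proof -
  interpret ring R by (rule ring_R)
  let ?K = "{f \<in> carrier R. \<forall>x y. hom_sum x y f = 0}"
  have "ideal ?K R"
  proof (rule idealI[OF ring_R])
    show "subgroup ?K (add_monoid R)"
    proof (rule group.subgroupI)
      show "group (add_monoid R)"
        by (rule a_group)
      show "?K \<noteq> {}"
        using zero_closed by (auto simp: path_algebra_def intro: exI[of _ 0])
      \<comment> \<open>Negation in the ring is the inverse of its additive monoid; it has to be
        identified with \<open>- a\<close> before the functionals can be evaluated on it.\<close>
      fix a assume a: "a \<in> ?K"
      have "a \<oplus>\<^bsub>R\<^esub> (- a) = \<zero>\<^bsub>R\<^esub>" "- a \<in> carrier R"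
        using a by (simp_all add: path_algebra_def)
      then have "inv\<^bsub>add_monoid R\<^esub> a = - a"
        using a minus_equality[of "- a" a] by (simp add: a_inv_def a_comm)
      then show "inv\<^bsub>add_monoid R\<^esub> a \<in> ?K"
        using a by (simp add: path_algebra_def)
    next
      fix a b assume "a \<in> ?K" "b \<in> ?K"
      then show "a \<otimes>\<^bsub>add_monoid R\<^esub> b \<in> ?K"
        using add.m_closed[of a b] by (simp add: path_algebra_def)
    qed auto
  next
    fix a g assume "a \<in> ?K" "g \<in> carrier R"
    then show "g \<otimes>\<^bsub>R\<^esub> a \<in> ?K" "a \<otimes>\<^bsub>R\<^esub> g \<in> ?K"
      using m_closed[of a g] m_closed[of g a]
      by (simp_all add: path_algebra_def hom_sum_path_mult_left hom_sum_path_mult_right)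
  qed
  moreover have "{Poly_Mapping.single p 1 - Poly_Mapping.single q 1 | p q.
        p \<in> paths Q \<and> q \<in> paths Q \<and> parallel p q} \<subseteq> ?K"
  proof safe
    fix p q assume pq: "p \<in> paths Q" "q \<in> paths Q" "parallel p q"
    then show "Poly_Mapping.single p 1 - Poly_Mapping.single q (1::'k) \<in> carrier R"
      using Poly_Mapping.keys_diff[of "Poly_Mapping.single p 1" "Poly_Mapping.single q (1::'k)"]
      by (auto simp: path_algebra_def)
    show "hom_sum x y (Poly_Mapping.single p 1 - Poly_Mapping.single q (1::'k)) = 0" for x y
      using pq by (cases p; cases q) auto
  qed
  ultimately have "I \<subseteq> ?K"
    unfolding I_eq parallel_ideal_def by (rule genideal_minimal)
  then show ?thesis
    using assms by blast
qed

lemma single_notin_ideal: "a \<noteq> 0 \<Longrightarrow> Poly_Mapping.single p a \<notin> I"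
  using hom_sum_in_ideal[of "Poly_Mapping.single p a" "fst p" "snd (snd p)"] by auto

text \<open>Trivial paths are the vertex idempotents. Sandwiching \<open>f\<close> between two of
  them keeps exactly its terms from \<open>x\<close> to \<open>y\<close>, so an ideal containing
  \<open>f\<close> contains each of these partial sums.\<close>

lemma path_mult_idempotents:
  "path_mult (Poly_Mapping.single (y, [], y) 1) (path_mult f (Poly_Mapping.single (x, [], x) 1)) =
     (\<Sum>p\<in>{p \<in> Poly_Mapping.keys f. fst p = x \<and> snd (snd p) = y}. Poly_Mapping.single p (Poly_Mapping.lookup f p))"
proof -
  have "Poly_Mapping.lookup (path_mult (Poly_Mapping.single (y, [], y) 1) (path_mult f (Poly_Mapping.single (x, [], x) 1))) p =
     (if fst p = x \<and> snd (snd p) = y then Poly_Mapping.lookup f p else 0)" for p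
  proof (induction f rule: poly_mapping_single_induct)
    case (2 q b)
    then show ?case
      by (cases p; cases q) (auto simp: path_mult_single Poly_Mapping.lookup_single when_def)
  qed (auto simp: path_mult_add_left path_mult_add_right Poly_Mapping.lookup_add)
  moreover have "Poly_Mapping.lookup (\<Sum>p\<in>{p \<in> Poly_Mapping.keys f. fst p = x \<and> snd (snd p) = y}. Poly_Mapping.single p (Poly_Mapping.lookup f p)) p =
     (if fst p = x \<and> snd (snd p) = y then Poly_Mapping.lookup f p else 0)" for p
    by (auto simp: Poly_Mapping.lookup_sum Poly_Mapping.lookup_single when_def in_keys_iff)
  ultimately show ?thesis
    by (intro poly_mapping_eqI) simp
qed

text \<open>The terms of \<open>f\<close> parallel to \<open>p\<close> form a nonempty partial sum
  that again lies in \<open>I\<close>. Minimality forbids it to be proper, so it is all of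
  \<open>f\<close>.\<close>

lemma minimal_relation_parallel:
  assumes min: "minimal_relation I f" and p: "p \<in> Poly_Mapping.keys f" and q: "q \<in> Poly_Mapping.keys f"
  shows "parallel p q"
proof -
  let ?x = "fst p" and ?y = "snd (snd p)"
  let ?J = "{q \<in> Poly_Mapping.keys f. fst q = ?x \<and> snd (snd q) = ?y}"
  have f: "f \<in> I"
    using min by (simp add: minimal_relation_def)
  have "p \<in> paths Q"
    using keys_in_ideal[OF f] p by blast
  then have xy: "?x \<in> verts Q" "?y \<in> verts Q"
    using awalk_hd_in_verts awalk_last_in_verts by (auto simp: paths_def)
  have e: "Poly_Mapping.single (x, [], x) 1 \<in> carrier R" if "x \<in> verts Q" for x
    using that by (simp add: path_algebra_def paths_def awalk_Nil_iff)
  have "path_mult (Poly_Mapping.single (?y, [], ?y) 1) (path_mult f (Poly_Mapping.single (?x, [], ?x) 1)) \<in> I"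
    using ideal.I_l_closed[OF ideal_I ideal.I_r_closed[OF ideal_I f e] e] xy
    by (simp add: path_algebra_def)
  then have in_I: "(\<Sum>q\<in>?J. Poly_Mapping.single q (Poly_Mapping.lookup f q)) \<in> I"
    by (simp add: path_mult_idempotents)
  have "?J \<noteq> {} \<and> ?J \<subset> Poly_Mapping.keys f \<longrightarrow>
      (\<Sum>q\<in>?J. Poly_Mapping.single q (Poly_Mapping.lookup f q)) \<notin> I"
    using min unfolding minimal_relation_def by (elim conjE allE)
  moreover have "?J \<noteq> {}"
    using p by blast
  ultimately have "\<not> ?J \<subset> Poly_Mapping.keys f"
    using in_I by linarith
  then have "?J = Poly_Mapping.keys f"
    by blast
  then have "q \<in> ?J"
    using q by simp
  then show ?thesis
    by (cases p; cases q) auto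
qed

section \<open>Equivalence of walks for the parallel ideal\<close>

lemma walks_simps:
  "(x, [], y) \<in> walks Q \<longleftrightarrow> x = y \<and> x \<in> verts Q"
  "(x, Inl a # p, y) \<in> walks Q \<longleftrightarrow> a \<in> arcs Q \<and> tail Q a = x \<and> (head Q a, p, y) \<in> walks Q"
  "(x, Inr a # p, y) \<in> walks Q \<longleftrightarrow> a \<in> arcs Q \<and> head Q a = x \<and> (tail Q a, p, y) \<in> walks Q"
proof -
  interpret D: wf_digraph "double_quiver Q"
    by (rule wf_digraph_double_quiver) (rule wf_digraph_axioms)
  note simps = walks_def paths_def D.awalk_Cons_iff D.awalk_Nil_iff
  show "(x, [], y) \<in> walks Q \<longleftrightarrow> x = y \<and> x \<in> verts Q"
    by (auto simp: simps) (auto simp: double_quiver_def)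
  show "(x, Inl a # p, y) \<in> walks Q \<longleftrightarrow> a \<in> arcs Q \<and> tail Q a = x \<and> (head Q a, p, y) \<in> walks Q"
    by (simp add: simps) (auto simp: double_quiver_def)
  show "(x, Inr a # p, y) \<in> walks Q \<longleftrightarrow> a \<in> arcs Q \<and> head Q a = x \<and> (tail Q a, p, y) \<in> walks Q"
    by (simp add: simps) (auto simp: double_quiver_def)
qed

lemma walks_append:
  assumes "(x, p, y) \<in> walks Q" "(y, q, z) \<in> walks Q"
  shows "(x, p @ q, z) \<in> walks Q"
proof -
  interpret D: wf_digraph "double_quiver Q"
    by (rule wf_digraph_double_quiver) (rule wf_digraph_axioms)
  show ?thesis
    using assms D.awalk_appendI by (auto simp: walks_def paths_def)
qed

lemma walk_of_path_in_walks:
  assumes "p \<in> paths Q"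
  shows "walk_of_path p \<in> walks Q"
proof -
  have "pre_digraph.cas (double_quiver Q) x (map Inl w) y = cas x w y" for x w y
    by (induction w arbitrary: x) (simp_all add: pre_digraph.cas.simps double_quiver_def)
  then show ?thesis
    using assms
    by (cases p) (auto simp: walks_def paths_def pre_digraph.awalk_def double_quiver_def)
qed

text \<open>For distinct paths the relation is their difference: a nonempty proper subset of its
  support is a single path, and no nonzero multiple of a path lies in \<open>I\<close>. For
  \<open>p = q\<close> the difference is \<open>0\<close> with empty support, so reflexivity is used
  instead.\<close>

lemma walk_equiv_parallel_paths:
  assumes p: "p \<in> paths Q" and q: "q \<in> paths Q" and "parallel p q"
  shows "walk_equiv Q I (walk_of_path p) (walk_of_path q)"
proof (cases "p = q")
  case True
  then show ?thesis
    using walk_of_path_in_walks[OF p] by (simp add: walk_equiv.refl)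
next
  case False
  let ?f = "Poly_Mapping.single p 1 - Poly_Mapping.single q (1::'k)"
  have lookup: "Poly_Mapping.lookup ?f r = (if r = p then 1 else if r = q then - 1 else 0)" for r
    using False by (auto simp: Poly_Mapping.lookup_minus Poly_Mapping.lookup_single)
  then have keys: "Poly_Mapping.keys ?f = {p, q}"
    by (auto simp: in_keys_iff split: if_splits)
  have "{Poly_Mapping.single p 1 - Poly_Mapping.single q (1::'k) | p q.
        p \<in> paths Q \<and> q \<in> paths Q \<and> parallel p q} \<subseteq> carrier R"
    using Poly_Mapping.keys_diff[of "Poly_Mapping.single _ 1" "Poly_Mapping.single _ (1::'k)"]
    by (fastforce simp: path_algebra_def)
  from ring.genideal_self[OF ring_R this] have "?f \<in> I"
    unfolding I_eq parallel_ideal_def using assms by blast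
  moreover have "(\<Sum>r\<in>J. Poly_Mapping.single r (Poly_Mapping.lookup ?f r)) \<notin> I"
    if "J \<noteq> {}" "J \<subset> {p, q}" for J
  proof -
    have "J = {p} \<or> J = {q}"
      using that by blast
    then show ?thesis
      using single_notin_ideal[of 1 p] single_notin_ideal[of "- 1" q] False by (auto simp: lookup)
  qed
  ultimately have "minimal_relation I ?f"
    unfolding minimal_relation_def keys by blast
  then show ?thesis
    by (rule walk_equiv.relation) (simp_all add: keys)
qed

text \<open>The clause for relations does not itself ask for paths of \<open>Q\<close> or for equal
  ends. Both follow for this ideal, whose elements are combinations of paths of \<open>Q\<close> and
  whose minimal relations have parallel terms.\<close>

lemma walk_equiv_parallel:
  assumes "walk_equiv Q I w w'"
  shows "w \<in> walks Q \<and> w' \<in> walks Q \<and> parallel w w'"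
proof -
  interpret D: wf_digraph "double_quiver Q"
    by (rule wf_digraph_double_quiver) (rule wf_digraph_axioms)
  have comp: "comp_path u v \<in> walks Q" if "u \<in> walks Q" "v \<in> walks Q" "composable u v" for u v
    using comp_path_in_paths[OF D.wf_digraph_axioms] that by (simp add: walks_def)
  have rel: "walk_of_path p \<in> walks Q" if "f \<in> I" "p \<in> Poly_Mapping.keys f" for p f
    using that keys_in_ideal walk_of_path_in_walks by blast
  have par: "parallel (walk_of_path p) (walk_of_path q) = parallel p q" for p q :: "('a, 'b) qpath"
    by (cases p; cases q) simp
  show ?thesis
    using assms
  proof induction
    case (refl w)
    then show ?case by (cases w) simp
  next
    case (sym w w')
    then show ?case by (cases w; cases w') auto
  next
    case (trans w w' w'')
    then show ?case by (cases w; cases w'; cases w'') auto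
  next
    case (relation f p q)
    then show ?case
      using minimal_relation_parallel[of f p q] rel[of f p] rel[of f q]
      by (simp add: par minimal_relation_def)
  next
    case (congruence w w' u v)
    have "composable (comp_path u w) v" "composable (comp_path u w') v"
      "parallel (comp_path (comp_path u w) v) (comp_path (comp_path u w') v)"
      using congruence by (cases w; cases w'; cases u; cases v; auto)+
    then show ?case
      using congruence by (blast intro: comp)
  qed (simp_all add: walks_simps head_in_verts tail_in_verts)
qed

end

section \<open>Walks as lists of arrows\<close>

text \<open>The inverse walk: running backwards exchanges every arrow with its formal
  inverse.\<close>

definition wrev :: "('b + 'b) list \<Rightarrow> ('b + 'b) list" where
  "wrev p = rev (map (case_sum Inr Inl) p)"

lemma wrev_wrev [simp]: "wrev (wrev p) = p"
  by (induction p) (auto simp: wrev_def rev_map split: sum.splits)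

lemma wrev_append [simp]: "wrev (p @ q) = wrev q @ wrev p"
  by (simp add: wrev_def)

lemma wrev_Nil [simp]: "wrev [] = []"
  by (simp add: wrev_def)

context finite_quiver
begin

text \<open>Fixing both ends reduces the groupoid of walk classes to a calculus of lists. They are
  written in the order of traversal, so composition is \<open>@\<close>, opposite to the order of
  \<open>comp_path\<close>.\<close>

definition weq :: "'a \<Rightarrow> 'a \<Rightarrow> ('b + 'b) list \<Rightarrow> ('b + 'b) list \<Rightarrow> bool" where
  "weq x y p q \<longleftrightarrow> walk_equiv Q I (x, p, y) (x, q, y)"

lemma weq_refl: "(x, p, y) \<in> walks Q \<Longrightarrow> weq x y p p"
  by (simp add: weq_def walk_equiv.refl)

lemma weq_sym: "weq x y p q \<Longrightarrow> weq x y q p"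
  by (simp add: weq_def walk_equiv.sym)

lemma weq_trans [trans]: "weq x y p q \<Longrightarrow> weq x y q r \<Longrightarrow> weq x y p r"
  unfolding weq_def by (rule walk_equiv.trans)

lemma weq_walks:
  assumes "weq x y p q"
  shows "(x, p, y) \<in> walks Q" "(x, q, y) \<in> walks Q"
  using walk_equiv_parallel[of "(x, p, y)" "(x, q, y)"] assms by (auto simp: weq_def)

lemma walks_verts:
  assumes "(x, p, y) \<in> walks Q"
  shows "x \<in> verts Q" "y \<in> verts Q"
proof -
  interpret D: wf_digraph "double_quiver Q"
    by (rule wf_digraph_double_quiver) (rule wf_digraph_axioms)
  show "x \<in> verts Q" "y \<in> verts Q"
    using assms D.awalk_hd_in_verts D.awalk_last_in_verts
    by (auto simp: walks_def paths_def double_quiver_def)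
qed

lemma weq_append:
  assumes p: "weq x y p p'" and q: "weq y z q q'"
  shows "weq x z (p @ q) (p' @ q')"
proof -
  have w: "(x, p, y) \<in> walks Q" "(x, p', y) \<in> walks Q" "(y, q, z) \<in> walks Q" "(y, q', z) \<in> walks Q"
    using weq_walks[OF p] weq_walks[OF q] by auto
  then have e: "(x, [], x) \<in> walks Q" "(z, [], z) \<in> walks Q"
    using walks_verts by (simp_all add: walks_simps)
  have "weq x z (p @ q) (p' @ q)"
    using walk_equiv.congruence[OF p[unfolded weq_def] w(3) e(1)] by (simp add: weq_def)
  also have "weq x z (p' @ q) (p' @ q')"
    using walk_equiv.congruence[OF q[unfolded weq_def] e(2) w(2)] by (simp add: weq_def)
  finally show ?thesis .
qed

lemma walks_wrev: "(x, p, y) \<in> walks Q \<Longrightarrow> (y, wrev p, x) \<in> walks Q"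
  unfolding wrev_def by (rule conjunct1[OF walk_equiv_inverse[OF wf_digraph_axioms]])

lemma weq_wrev_right: "(x, p, y) \<in> walks Q \<Longrightarrow> weq x x (p @ wrev p) []"
  unfolding wrev_def weq_def by (rule conjunct2[OF walk_equiv_inverse[OF wf_digraph_axioms]])

lemma weq_wrev_left: "(x, p, y) \<in> walks Q \<Longrightarrow> weq y y (wrev p @ p) []"
  using weq_wrev_right[OF walks_wrev] by simp

lemma weq_cancel_left:
  assumes "(x, p, y) \<in> walks Q" "weq x z (p @ q) (p @ q')" "(y, q, z) \<in> walks Q" "(y, q', z) \<in> walks Q"
  shows "weq y z q q'"
proof -
  have *: "weq y z ([] @ r) ((wrev p @ p) @ r)" if "(y, r, z) \<in> walks Q" for r
    using weq_append[OF weq_sym[OF weq_wrev_left[OF assms(1)]] weq_refl[OF that]] .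
  have "weq y z q (wrev p @ (p @ q))"
    using *[OF assms(3)] by simp
  also have "weq y z \<dots> (wrev p @ (p @ q'))"
    using weq_append[OF weq_refl[OF walks_wrev[OF assms(1)]] assms(2)] .
  also have "weq y z \<dots> q'"
    using weq_sym[OF *[OF assms(4)]] by simp
  finally show ?thesis .
qed

text \<open>Compatibility with inverses is not a generating clause; it follows from uniqueness of
  inverses. Both \<open>p @ wrev p\<close> and \<open>q @ wrev q\<close> are trivial; replacing the
  first \<open>q\<close> by \<open>p\<close> and cancelling \<open>p\<close> gives the
  claim.\<close>

lemma weq_wrev:
  assumes "weq x y p q"
  shows "weq y x (wrev p) (wrev q)"
proof -
  note w = weq_walks[OF assms]
  have "weq x x (p @ wrev p) []"
    by (rule weq_wrev_right) (rule w)
  also have "weq x x [] (q @ wrev q)"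
    by (rule weq_sym) (rule weq_wrev_right[OF w(2)])
  also have "weq x x \<dots> (p @ wrev q)"
    by (intro weq_append[OF weq_sym[OF assms]] weq_refl walks_wrev w)
  finally show ?thesis
    by (rule weq_cancel_left[OF w(1)]) (intro walks_wrev w)+
qed

lemma weq_cancel_right:
  assumes "(y, q, z) \<in> walks Q" "weq x z (p @ q) (p' @ q)" "(x, p, y) \<in> walks Q" "(x, p', y) \<in> walks Q"
  shows "weq x y p p'"
proof -
  have "weq z x (wrev q @ wrev p) (wrev q @ wrev p')"
    using weq_wrev[OF assms(2)] by simp
  from weq_cancel_left[OF walks_wrev[OF assms(1)] this] have "weq y x (wrev p) (wrev p')"
    using assms by (simp add: walks_wrev)
  from weq_wrev[OF this] show ?thesis
    by simp
qed

lemma weq_paths: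
  assumes "(x, p, y) \<in> paths Q" "(x, q, y) \<in> paths Q"
  shows "weq x y (map Inl p) (map Inl q)"
  using walk_equiv_parallel_paths[OF assms] by (simp add: weq_def)

end

section \<open>Walks through a sequence of simplexes\<close>

locale complex_quiver = finite_quiver "ordered_quiver (Pos S)" I
  for S :: "'v set set" and I :: "(('v set, 'v set \<times> 'v set) qpath \<Rightarrow>\<^sub>0 'k::field) set" +
  fixes V :: "'v set"
  assumes abstract_complex: "abstract_complex V S" and finite_V: "finite V"
begin

abbreviation Q :: "('v set, 'v set \<times> 'v set) pre_digraph" where
  "Q \<equiv> ordered_quiver (Pos S)"

lemma finite_simplex: "\<sigma> \<in> S \<Longrightarrow> finite \<sigma>"
  and simplex_subset: "\<sigma> \<in> S \<Longrightarrow> \<sigma> \<subseteq> V"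
  and face: "\<sigma> \<in> S \<Longrightarrow> \<tau> \<subseteq> \<sigma> \<Longrightarrow> \<tau> \<in> S"
  and vertex: "v \<in> V \<Longrightarrow> {v} \<in> S"
  using abstract_complex by (auto simp: abstract_complex_def)

lemma verts_Q: "verts Q = S - {{}}"
  by (simp add: ordered_quiver_def Field_Pos)

lemma arcs_Q: "(\<sigma>, \<tau>) \<in> arcs Q \<Longrightarrow> \<sigma> \<in> S \<and> \<tau> \<in> S \<and> \<sigma> \<noteq> {} \<and> \<sigma> \<subset> \<tau>"
  by (auto simp: ordered_quiver_def Pos_def)

lemma ends_Q [simp]: "tail Q = fst" "head Q = snd"
  by (simp_all add: ordered_quiver_def)

text \<open>The missing vertices are added one at a time; the intermediate sets are simplexes
  because they are faces of \<open>\<tau>\<close>.\<close>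

lemma path_exists:
  assumes "\<sigma> \<subseteq> \<tau>" "\<sigma> \<noteq> {}" "\<tau> \<in> S"
  shows "\<exists>p. (\<sigma>, p, \<tau>) \<in> paths Q"
  using assms
proof (induction "card (\<tau> - \<sigma>)" arbitrary: \<sigma>)
  case 0
  then have "\<tau> = \<sigma>"
    using finite_simplex[of \<tau>] by auto
  then show ?case
    using 0 by (intro exI[of _ "[]"]) (simp add: paths_def awalk_Nil_iff verts_Q)
next
  case (Suc n)
  then have "card (\<tau> - \<sigma>) \<noteq> card {}"
    by simp
  then have "\<tau> - \<sigma> \<noteq> {}"
    by (rule contrapos_nn) (rule arg_cong)
  then obtain v where v: "v \<in> \<tau>" "v \<notin> \<sigma>"
    by blast
  then have "card (\<tau> - insert v \<sigma>) = card (\<tau> - \<sigma>) - 1"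
    by (simp add: Diff_insert[of \<tau> v \<sigma>])
  then have "n = card (\<tau> - insert v \<sigma>)"
    unfolding Suc.hyps(2)[symmetric] by simp
  then obtain p where p: "(insert v \<sigma>, p, \<tau>) \<in> paths Q"
    using Suc.hyps(1)[of "insert v \<sigma>"] Suc.prems v by auto
  have "insert v \<sigma> \<in> S" "\<sigma> \<in> S"
    using Suc.prems v face by (metis insert_subset)+
  \<comment> \<open>No set lies strictly between a set and its extension by one element, so this
    pair is a covering relation.\<close>
  then have "(\<sigma>, insert v \<sigma>) \<in> arcs Q"
    using v Suc.prems by (auto simp: ordered_quiver_def Pos_def)
  then have "(\<sigma>, (\<sigma>, insert v \<sigma>) # p, \<tau>) \<in> paths Q"
    using p by (simp add: paths_def awalk_Cons_iff)
  then show ?case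
    by blast
qed

text \<open>Any choice will do, since paths with the same ends are equivalent. There is something to
  choose when \<open>\<sigma>\<close> is a nonempty face of a simplex \<open>\<tau>\<close>.\<close>

definition up :: "'v set \<Rightarrow> 'v set \<Rightarrow> ('v set \<times> 'v set + 'v set \<times> 'v set) list" where
  "up \<sigma> \<tau> = map Inl (SOME p. (\<sigma>, p, \<tau>) \<in> paths Q)"

lemma weq_up:
  assumes "\<sigma> \<subseteq> \<tau>" "\<sigma> \<noteq> {}" "\<tau> \<in> S" "(\<sigma>, p, \<tau>) \<in> paths Q"
  shows "weq \<sigma> \<tau> (up \<sigma> \<tau>) (map Inl p)"
  unfolding up_def by (rule weq_paths[OF someI_ex[OF path_exists[OF assms(1-3)]] assms(4)])

lemma walks_up: "\<sigma> \<subseteq> \<tau> \<Longrightarrow> \<sigma> \<noteq> {} \<Longrightarrow> \<tau> \<in> S \<Longrightarrow> (\<sigma>, up \<sigma> \<tau>, \<tau>) \<in> walks Q"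
  using weq_walks(1)[OF weq_up[OF _ _ _ someI_ex[OF path_exists]]] by auto

lemma weq_up_refl: "\<sigma> \<in> S \<Longrightarrow> \<sigma> \<noteq> {} \<Longrightarrow> weq \<sigma> \<sigma> (up \<sigma> \<sigma>) []"
  using weq_up[of \<sigma> \<sigma> "[]"] by (auto simp: paths_def awalk_Nil_iff verts_Q)

lemma weq_up_up:
  assumes "\<rho> \<subseteq> \<sigma>" "\<sigma> \<subseteq> \<tau>" "\<rho> \<noteq> {}" "\<tau> \<in> S"
  shows "weq \<rho> \<tau> (up \<rho> \<sigma> @ up \<sigma> \<tau>) (up \<rho> \<tau>)"
proof -
  have "\<sigma> \<in> S" "\<sigma> \<noteq> {}"
    using assms face by auto
  with assms obtain p q where pq: "(\<rho>, p, \<sigma>) \<in> paths Q" "(\<sigma>, q, \<tau>) \<in> paths Q"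
    using path_exists by meson
  have "(\<rho>, p @ q, \<tau>) \<in> paths Q"
    using pq by (auto simp: paths_def intro: awalk_appendI)
  then have "weq \<rho> \<tau> (map Inl p @ map Inl q) (up \<rho> \<tau>)"
    using weq_sym[OF weq_up[of \<rho> \<tau> "p @ q"]] assms by simp
  moreover have "weq \<rho> \<tau> (up \<rho> \<sigma> @ up \<sigma> \<tau>) (map Inl p @ map Inl q)"
    using weq_up pq assms \<open>\<sigma> \<in> S\<close> \<open>\<sigma> \<noteq> {}\<close> by (intro weq_append) auto
  ultimately show ?thesis
    using weq_trans by blast
qed

definition tr :: "'v set \<Rightarrow> 'v set \<Rightarrow> ('v set \<times> 'v set + 'v set \<times> 'v set) list" where
  "tr \<sigma> \<tau> = wrev (up (\<sigma> \<inter> \<tau>) \<sigma>) @ up (\<sigma> \<inter> \<tau>) \<tau>"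

lemma walks_tr: "\<sigma> \<in> S \<Longrightarrow> \<tau> \<in> S \<Longrightarrow> \<sigma> \<inter> \<tau> \<noteq> {} \<Longrightarrow> (\<sigma>, tr \<sigma> \<tau>, \<tau>) \<in> walks Q"
  unfolding tr_def
  by (rule walks_append[OF walks_wrev[OF walks_up] walks_up]) auto

text \<open>Upward paths from \<open>\<rho>\<close> can be routed through the intersection, and the
  stretch between \<open>\<rho>\<close> and the intersection is then run through back and forth and
  cancels. So every nonempty common face gives the same transport.\<close>

lemma weq_tr:
  assumes "\<sigma> \<in> S" "\<tau> \<in> S" "\<rho> \<subseteq> \<sigma> \<inter> \<tau>" "\<rho> \<noteq> {}"
  shows "weq \<sigma> \<tau> (tr \<sigma> \<tau>) (wrev (up \<rho> \<sigma>) @ up \<rho> \<tau>)"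
proof -
  let ?\<mu> = "\<sigma> \<inter> \<tau>"
  have \<mu>: "?\<mu> \<noteq> {}" "?\<mu> \<in> S"
    using assms face[of \<sigma> ?\<mu>] by auto
  have w: "(\<rho>, up \<rho> ?\<mu>, ?\<mu>) \<in> walks Q" "(?\<mu>, up ?\<mu> \<sigma>, \<sigma>) \<in> walks Q" "(?\<mu>, up ?\<mu> \<tau>, \<tau>) \<in> walks Q"
    using assms \<mu> by (auto intro: walks_up)
  have "weq \<sigma> \<rho> (wrev (up \<rho> \<sigma>)) (wrev (up \<rho> ?\<mu> @ up ?\<mu> \<sigma>))"
    using assms by (intro weq_wrev weq_sym[OF weq_up_up]) auto
  moreover have "weq \<rho> \<tau> (up \<rho> \<tau>) (up \<rho> ?\<mu> @ up ?\<mu> \<tau>)"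
    using assms by (intro weq_sym[OF weq_up_up]) auto
  ultimately have "weq \<sigma> \<tau> (wrev (up \<rho> \<sigma>) @ up \<rho> \<tau>)
      (wrev (up \<rho> ?\<mu> @ up ?\<mu> \<sigma>) @ (up \<rho> ?\<mu> @ up ?\<mu> \<tau>))"
    by (rule weq_append)
  also have "(wrev (up \<rho> ?\<mu> @ up ?\<mu> \<sigma>) @ (up \<rho> ?\<mu> @ up ?\<mu> \<tau>)) =
      wrev (up ?\<mu> \<sigma>) @ ((wrev (up \<rho> ?\<mu>) @ up \<rho> ?\<mu>) @ up ?\<mu> \<tau>)"
    by simp
  also have "weq \<sigma> \<tau> \<dots> (wrev (up ?\<mu> \<sigma>) @ ([] @ up ?\<mu> \<tau>))"
    by (rule weq_append[OF weq_refl[OF walks_wrev[OF w(2)]]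
        weq_append[OF weq_wrev_left[OF w(1)] weq_refl[OF w(3)]]])
  finally show ?thesis
    unfolding tr_def append_Nil by (rule weq_sym)
qed

lemma weq_tr_refl:
  assumes "\<sigma> \<in> S" "\<sigma> \<noteq> {}"
  shows "weq \<sigma> \<sigma> (tr \<sigma> \<sigma>) []"
  unfolding tr_def Int_absorb using assms by (intro weq_wrev_left[OF walks_up]) auto

text \<open>All transports are rewritten to pass through \<open>{v}\<close>, where the two middle
  legs cancel. The vertex must be common to all three simplexes: the edges of a hollow triangle meet
  pairwise, yet transport around them is not trivial.\<close>

lemma weq_tr_tr:
  assumes S: "\<sigma> \<in> S" "\<tau> \<in> S" "\<upsilon> \<in> S" and v: "v \<in> \<sigma>" "v \<in> \<tau>" "v \<in> \<upsilon>"
  shows "weq \<sigma> \<upsilon> (tr \<sigma> \<tau> @ tr \<tau> \<upsilon>) (tr \<sigma> \<upsilon>)"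
proof -
  have w: "({v}, up {v} \<rho>, \<rho>) \<in> walks Q" if "v \<in> \<rho>" "\<rho> \<in> S" for \<rho>
    using that by (intro walks_up) auto
  have "weq \<sigma> \<upsilon> (tr \<sigma> \<tau> @ tr \<tau> \<upsilon>) ((wrev (up {v} \<sigma>) @ up {v} \<tau>) @ (wrev (up {v} \<tau>) @ up {v} \<upsilon>))"
    using S v by (intro weq_append[where y = \<tau>] weq_tr) auto
  also have "\<dots> = wrev (up {v} \<sigma>) @ ((up {v} \<tau> @ wrev (up {v} \<tau>)) @ up {v} \<upsilon>)"
    by simp
  also have "weq \<sigma> \<upsilon> \<dots> (wrev (up {v} \<sigma>) @ ([] @ up {v} \<upsilon>))"
    using S v
    by (intro weq_append[OF weq_refl[OF walks_wrev[OF w]]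
          weq_append[OF weq_wrev_right[OF w] weq_refl[OF w]]])
  also have "\<dots> = wrev (up {v} \<sigma>) @ up {v} \<upsilon>"
    by simp
  also have "weq \<sigma> \<upsilon> \<dots> (tr \<sigma> \<upsilon>)"
    using S v by (intro weq_sym[OF weq_tr]) auto
  finally show ?thesis .
qed

text \<open>Here \<open>n\<close> counts steps, so the walk visits the \<open>n + 1\<close>
  simplexes from \<open>s 0\<close> to \<open>s n\<close>.\<close>

definition gw :: "(nat \<Rightarrow> 'v set) \<Rightarrow> nat \<Rightarrow> ('v set \<times> 'v set + 'v set \<times> 'v set) list" where
  "gw s n = concat (map (\<lambda>i. tr (s i) (s (Suc i))) [0..<n])"

lemma gw_0 [simp]: "gw s 0 = []"
  and gw_Suc: "gw s (Suc n) = gw s n @ tr (s n) (s (Suc n))"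
  by (simp_all add: gw_def)

lemma gw_cong: "(\<And>i. i \<le> n \<Longrightarrow> s i = t i) \<Longrightarrow> gw s n = gw t n"
  by (induction n) (simp_all add: gw_Suc)

lemma gw_add: "gw s (m + n) = gw s m @ gw (\<lambda>i. s (m + i)) n"
  by (induction n) (simp_all add: gw_Suc)

lemma walks_gw:
  assumes "\<And>i. i \<le> n \<Longrightarrow> s i \<in> S - {{}}" "\<And>i. i < n \<Longrightarrow> s i \<inter> s (Suc i) \<noteq> {}"
  shows "(s 0, gw s n, s n) \<in> walks Q"
  using assms
proof (induction n)
  case 0
  then show ?case
    by (simp add: walks_simps verts_Q)
next
  case (Suc n)
  have "(s 0, gw s n, s n) \<in> walks Q"
    using Suc by simp
  moreover have "(s n, tr (s n) (s (Suc n)), s (Suc n)) \<in> walks Q"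
    using Suc.prems(1)[of n] Suc.prems(1)[of "Suc n"] Suc.prems(2)[of n] by (intro walks_tr) auto
  ultimately show ?case
    by (auto simp: gw_Suc intro: walks_append)
qed

text \<open>A discrete homotopy: the four corners of every square share a vertex, so both ways round
  it agree and the rung can be pushed from one end of the ladder to the other. The condition on
  \<open>s 0\<close> and \<open>t 0\<close> covers the ladder without squares.\<close>

lemma weq_gw_ladder:
  assumes "\<And>i. i \<le> n \<Longrightarrow> s i \<in> S" "\<And>i. i \<le> n \<Longrightarrow> t i \<in> S"
    and "s 0 \<inter> t 0 \<noteq> {}"
    and "\<And>i. i < n \<Longrightarrow> s i \<inter> s (Suc i) \<inter> t i \<inter> t (Suc i) \<noteq> {}"
  shows "weq (s 0) (t n) (gw s n @ tr (s n) (t n)) (tr (s 0) (t 0) @ gw t n)"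
  using assms
proof (induction n)
  case 0
  then show ?case
    by (auto intro: weq_refl walks_tr)
next
  case (Suc n)
  obtain v where v: "v \<in> s n" "v \<in> s (Suc n)" "v \<in> t n" "v \<in> t (Suc n)"
    using Suc.prems(4)[of n] by auto
  have S: "s n \<in> S" "s (Suc n) \<in> S" "t n \<in> S" "t (Suc n) \<in> S"
    using Suc.prems(1,2) by auto
  have IH: "weq (s 0) (t n) (gw s n @ tr (s n) (t n)) (tr (s 0) (t 0) @ gw t n)"
    using Suc by auto
  have *: "(s 0, gw s n, s n) \<in> walks Q"
  proof (rule walks_gw)
    show "s i \<in> S - {{}}" if "i \<le> n" for i
      using that Suc.prems(1)[of i] Suc.prems(4)[of i] by auto
    show "s i \<inter> s (Suc i) \<noteq> {}" if "i < n" for i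
      using that Suc.prems(4)[of i] by auto
  qed
  \<comment> \<open>Both ways round the last square are compared with its diagonal from
    \<open>s n\<close> to \<open>t (Suc n)\<close>.\<close>
  have "weq (s 0) (t (Suc n)) (gw s n @ (tr (s n) (s (Suc n)) @ tr (s (Suc n)) (t (Suc n))))
      (gw s n @ tr (s n) (t (Suc n)))"
    using S v by (intro weq_append[OF weq_refl[OF *]] weq_tr_tr[where v = v])
  also have "weq (s 0) (t (Suc n)) \<dots> (gw s n @ (tr (s n) (t n) @ tr (t n) (t (Suc n))))"
    using S v by (intro weq_append[OF weq_refl[OF *]] weq_sym[OF weq_tr_tr[where v = v]])
  also have "\<dots> = (gw s n @ tr (s n) (t n)) @ tr (t n) (t (Suc n))"
    by simp
  also have "weq (s 0) (t (Suc n)) \<dots> ((tr (s 0) (t 0) @ gw t n) @ tr (t n) (t (Suc n)))"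
    using S v by (intro weq_append[OF IH] weq_refl walks_tr) auto
  finally show ?case
    by (simp add: gw_Suc)
qed

lemma weq_gw_block:
  assumes "\<And>i. i \<le> n \<Longrightarrow> s i \<in> S" "\<And>i. i \<le> n \<Longrightarrow> v \<in> s i"
  shows "weq (s 0) (s n) (gw s n) (tr (s 0) (s n))"
  using assms
proof (induction n)
  case 0
  then show ?case
    using weq_sym[OF weq_tr_refl] by auto
next
  case (Suc n)
  have "weq (s 0) (s (Suc n)) (gw s (Suc n)) (tr (s 0) (s n) @ tr (s n) (s (Suc n)))"
    unfolding gw_Suc using Suc.prems(1)[of n] Suc.prems(2)[of n] Suc.prems(1)[of "Suc n"] Suc.prems(2)[of "Suc n"]
    by (intro weq_append[where y = "s n"] Suc.IH Suc.prems weq_refl walks_tr) auto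
  also have "weq (s 0) (s (Suc n)) \<dots> (tr (s 0) (s (Suc n)))"
    using Suc.prems by (intro weq_tr_tr[where v = v]) auto
  finally show ?case .
qed

text \<open>Each of the \<open>n\<close> blocks of \<open>m\<close> steps has a vertex common to its
  \<open>m + 1\<close> simplexes, both ends included, and so collapses to a single
  transport.\<close>

lemma weq_gw_refine:
  assumes "\<And>i. i \<le> n * m \<Longrightarrow> s i \<in> S - {{}}"
    and "\<And>j. j < n \<Longrightarrow> \<exists>v. \<forall>i\<le>m. v \<in> s (j * m + i)"
  shows "weq (s 0) (s (n * m)) (gw s (n * m)) (gw (\<lambda>j. s (j * m)) n)"
  using assms
proof (induction n)
  case 0
  then show ?case
    by (simp add: weq_refl walks_simps verts_Q)
next
  case (Suc n)
  obtain v where v: "\<And>i. i \<le> m \<Longrightarrow> v \<in> s (n * m + i)"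
    using Suc.prems(2)[of n] by blast
  have "gw s (Suc n * m) = gw s (n * m) @ gw (\<lambda>i. s (n * m + i)) m"
    using gw_add[of s "n * m" m] by (simp add: add.commute)
  also have "weq (s 0) (s (Suc n * m)) \<dots> (gw (\<lambda>j. s (j * m)) n @ tr (s (n * m)) (s (Suc n * m)))"
  proof (rule weq_append)
    show "weq (s 0) (s (n * m)) (gw s (n * m)) (gw (\<lambda>j. s (j * m)) n)"
      using Suc by simp
    show "weq (s (n * m)) (s (Suc n * m)) (gw (\<lambda>i. s (n * m + i)) m) (tr (s (n * m)) (s (Suc n * m)))"
      using weq_gw_block[of m "\<lambda>i. s (n * m + i)" v] v Suc.prems(1) by (simp add: add.commute)
  qed
  finally show ?case
    by (simp add: gw_Suc)
qed

end

section \<open>Transport along paths of the realization\<close>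

text \<open>The difference is one summand of the distance, which is the \<open>l1\<close> one. All
  coordinates are thus 1-Lipschitz, with the same constant for every vertex.\<close>

lemma abs_lookup_diff_le_dist:
  fixes x y :: "'v \<Rightarrow>\<^sub>0 real"
  shows "\<bar>Poly_Mapping.lookup x v - Poly_Mapping.lookup y v\<bar> \<le> dist x y"
proof (cases "v \<in> Poly_Mapping.keys x \<union> Poly_Mapping.keys y")
  case True
  have "dist (Poly_Mapping.lookup x v) (Poly_Mapping.lookup y v) \<le> dist x y"
    unfolding dist_poly_mapping_def by (rule member_le_sum[OF True]) auto
  then show ?thesis
    by (simp add: dist_real_def)
qed (simp add: in_keys_iff)

text \<open>Every piece of the subdivision of \<open>p\<close> into \<open>n\<close> equal parts lies in the open star of a vertex.\<close>

definition star_fine :: "nat \<Rightarrow> (real \<Rightarrow> 'v \<Rightarrow>\<^sub>0 real) \<Rightarrow> bool" where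
  "star_fine n p \<longleftrightarrow> 0 < n \<and> (\<forall>j<n. \<exists>v. \<forall>t\<in>{real j / real n..real (Suc j) / real n}. v \<in> Poly_Mapping.keys (p t))"

lemma star_fine_mult:
  assumes "star_fine n p" "0 < m"
  shows "star_fine (n * m) p"
  unfolding star_fine_def
proof (intro conjI allI impI)
  show "0 < n * m"
    using assms by (simp add: star_fine_def)
  fix j assume "j < n * m"
  \<comment> \<open>Piece \<open>j\<close> of the finer subdivision lies in piece
    \<open>j div m\<close> of the coarser one and inherits its vertex.\<close>
  then have "j div m < n"
    using assms(2) by (simp add: less_mult_imp_div_less)
  then obtain v where v: "\<forall>t\<in>{real (j div m) / real n..real (Suc (j div m)) / real n}. v \<in> Poly_Mapping.keys (p t)"
    using assms(1) by (auto simp: star_fine_def)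
  have pos: "0 < real n" "0 < real m"
    using assms by (auto simp: star_fine_def)
  have "j div m * m \<le> j" "Suc j \<le> Suc (j div m) * m"
    using assms(2) by (simp_all add: div_times_less_eq_dividend dividend_less_div_times Suc_le_eq add.commute)
  then have "real (j div m) * real m \<le> real j" "real (Suc j) \<le> real (Suc (j div m)) * real m"
    using of_nat_mono by (metis of_nat_mult)+
  then have "real (j div m) / real n \<le> real j / real (n * m)"
    "real (Suc j) / real (n * m) \<le> real (Suc (j div m)) / real n"
    using pos by (simp_all add: field_simps del: of_nat_Suc)
  then show "\<exists>v. \<forall>t\<in>{real j / real (n * m)..real (Suc j) / real (n * m)}. v \<in> Poly_Mapping.keys (p t)"
    using v by (intro exI[of _ v]) auto
qed

text \<open>With an even number of pieces the junction \<open>1 / 2\<close> is a point of the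
  subdivision, so every piece lies in one half.\<close>

lemma star_fine_join:
  assumes p: "star_fine n p" and q: "star_fine n q" and pq: "pathfinish p = pathstart q"
  shows "star_fine (2 * n) (p +++ q)"
  unfolding star_fine_def
proof (intro conjI allI impI)
  have n: "0 < real n"
    using p by (simp add: star_fine_def)
  then show "0 < 2 * n"
    by simp
  fix j assume j: "j < 2 * n"
  show "\<exists>v. \<forall>t\<in>{real j / real (2 * n)..real (Suc j) / real (2 * n)}. v \<in> Poly_Mapping.keys ((p +++ q) t)"
  proof (cases "j < n")
    case True
    then obtain v where v: "\<forall>t\<in>{real j / real n..real (Suc j) / real n}. v \<in> Poly_Mapping.keys (p t)"
      using p by (auto simp: star_fine_def)
    have "v \<in> Poly_Mapping.keys ((p +++ q) t)"
      if t: "t \<in> {real j / real (2 * n)..real (Suc j) / real (2 * n)}" for t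
    proof -
      have "t \<le> real (Suc j) / real (2 * n)"
        using t by simp
      also have "\<dots> \<le> 1 / 2"
        using True n by (simp add: field_simps)
      finally have "t \<le> 1 / 2" .
      moreover have "2 * t \<in> {real j / real n..real (Suc j) / real n}"
        using t n by (simp add: field_simps)
      ultimately show ?thesis
        using v by (auto simp: joinpaths_def)
    qed
    then show ?thesis
      by blast
  next
    case False
    then have "j - n < n"
      using j by simp
    then obtain v where v: "\<forall>t\<in>{real (j - n) / real n..real (Suc (j - n)) / real n}. v \<in> Poly_Mapping.keys (q t)"
      using q unfolding star_fine_def by blast
    have "v \<in> Poly_Mapping.keys ((p +++ q) t)"
      if t: "t \<in> {real j / real (2 * n)..real (Suc j) / real (2 * n)}" for t
    proof -
      have "1 / 2 \<le> real j / real (2 * n)"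
        using False n by (simp add: field_simps)
      also have "\<dots> \<le> t"
        using t by simp
      finally have "1 / 2 \<le> t" .
      moreover have "2 * t - 1 \<in> {real (j - n) / real n..real (Suc (j - n)) / real n}"
        using t n False by (simp add: of_nat_diff field_simps)
      \<comment> \<open>At \<open>1 / 2\<close> the join takes its value from \<open>p\<close>; only
        the agreement of the end points makes it a value of \<open>q\<close>.\<close>
      moreover have "(p +++ q) t = q (2 * t - 1)" if "1 / 2 \<le> t"
      proof (cases "t = 1 / 2")
        case True
        then show ?thesis
          using pq unfolding True by (simp add: joinpaths_def pathstart_def pathfinish_def)
      qed (use that in \<open>simp add: joinpaths_def\<close>)
      ultimately show ?thesis
        using v by auto
    qed
    then show ?thesis
      by blast
  qed
qed

context complex_quiver
begin

section \<open>Carriers of points and star-fine grids\<close>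

abbreviation X :: "('v \<Rightarrow>\<^sub>0 real) set" where
  "X \<equiv> geometric_realization S"

text \<open>The support of a point is the smallest simplex whose closed simplex contains it, so
  carriers need not be chosen: they are \<open>Poly_Mapping.keys x\<close>.\<close>

lemma in_realization_iff:
  "x \<in> X \<longleftrightarrow> Poly_Mapping.keys x \<in> S \<and> (\<forall>v. 0 \<le> Poly_Mapping.lookup x v) \<and>
     (\<Sum>v\<in>Poly_Mapping.keys x. Poly_Mapping.lookup x v) = 1"
  using face by (auto simp: geometric_realization_def closed_simplex_def)

lemma keys_in_complex:
  assumes "x \<in> X"
  shows "Poly_Mapping.keys x \<in> S - {{}}"
  using assms by (auto simp: in_realization_iff simp del: keys_eq_empty)

text \<open>At most \<open>card V\<close> coordinates add up to 1, so not all are below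
  \<open>1 / card V\<close>. The bound is a Lebesgue number for the cover by open stars: points
  closer than this to \<open>x\<close> keep the coordinate positive.\<close>

lemma large_coordinate:
  assumes "x \<in> X"
  shows "\<exists>v. 1 / real (card V) \<le> Poly_Mapping.lookup x v"
proof (rule ccontr)
  assume "\<not> ?thesis"
  then have *: "Poly_Mapping.lookup x v < 1 / real (card V)" for v
    by (simp add: not_le)
  have keys: "Poly_Mapping.keys x \<noteq> {}" "Poly_Mapping.keys x \<subseteq> V"
    using keys_in_complex[OF assms] simplex_subset by blast+
  then have "0 < card V"
    using finite_V finite_subset[OF keys(2)] card_gt_0_iff[of V] by blast
  have "1 = (\<Sum>v\<in>Poly_Mapping.keys x. Poly_Mapping.lookup x v)"
    using assms by (simp add: in_realization_iff)
  also have "\<dots> < (\<Sum>v\<in>Poly_Mapping.keys x. 1 / real (card V))"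
    using keys * by (intro sum_strict_mono) auto
  also have "\<dots> = real (card (Poly_Mapping.keys x)) / real (card V)"
    by simp
  also have "\<dots> \<le> 1"
    using card_mono[OF finite_V keys(2)] \<open>0 < card V\<close> by simp
  finally show False
    by simp
qed

text \<open>The vertex of a cell is one with a large coordinate at the corner with the smallest
  parameters. Uniform continuity keeps the image of the cell within \<open>1 / card V\<close> of the
  image of that corner, so the coordinate stays positive.\<close>

lemma star_fine_grid:
  fixes h :: "real \<times> real \<Rightarrow> 'v \<Rightarrow>\<^sub>0 real"
  assumes cont: "continuous_on ({0..1} \<times> {0..1}) h" and h: "h \<in> {0..1} \<times> {0..1} \<rightarrow> X"
  obtains n where "0 < n"
    "\<And>i j. i < n \<Longrightarrow> j < n \<Longrightarrow> \<exists>v. \<forall>s\<in>{real i / real n..real (Suc i) / real n}.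
       \<forall>t\<in>{real j / real n..real (Suc j) / real n}. v \<in> Poly_Mapping.keys (h (s, t))"
proof -
  let ?K = "{0..1} \<times> {0..1} :: (real \<times> real) set"
  have "h (0, 0) \<in> X"
    using h by auto
  then have "V \<noteq> {}"
    using keys_in_complex[of "h (0, 0)"] simplex_subset by blast
  then have "0 < 1 / real (card V)"
    using finite_V by (simp add: card_gt_0_iff)
  moreover have "uniformly_continuous_on ?K h"
    by (intro compact_uniformly_continuous cont compact_Times) auto
  ultimately obtain \<delta> where \<delta>: "0 < \<delta>"
    "\<And>x y. x \<in> ?K \<Longrightarrow> y \<in> ?K \<Longrightarrow> dist y x < \<delta> \<Longrightarrow> dist (h y) (h x) < 1 / real (card V)"
    unfolding uniformly_continuous_on_def by meson
  \<comment> \<open>Within a cell each parameter is off that of the corner by at most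
    \<open>1 / n\<close>, so the distance is at most \<open>2 / n\<close>, which has to be below
    \<open>\<delta>\<close>.\<close>
  obtain n :: nat where n: "2 / \<delta> < real n"
    using reals_Archimedean2 by blast
  moreover have "0 < 2 / \<delta>"
    using \<delta> by simp
  ultimately have pos: "0 < real n"
    by linarith
  show thesis
  proof
    show "0 < n"
      using pos by simp
    fix i j assume ij: "i < n" "j < n"
    have le1: "real (Suc k) / real n \<le> 1" if "k < n" for k
      using that pos by (simp add: field_simps)
    let ?z = "(real i / real n, real j / real n)"
    have z: "?z \<in> ?K"
      using ij by simp
    then have "h ?z \<in> X"
      using h by blast
    then obtain v where v: "1 / real (card V) \<le> Poly_Mapping.lookup (h ?z) v"
      using large_coordinate by blast
    have "v \<in> Poly_Mapping.keys (h (s, t))"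
      if s: "s \<in> {real i / real n..real (Suc i) / real n}"
        and t: "t \<in> {real j / real n..real (Suc j) / real n}" for s t
    proof -
      have "0 \<le> real i / real n" "0 \<le> real j / real n"
        by simp_all
      then have "0 \<le> s" "0 \<le> t"
        using s t unfolding atLeastAtMost_iff by linarith+
      then have "(s, t) \<in> ?K"
        using s t le1[OF ij(1)] le1[OF ij(2)] by (auto simp del: of_nat_Suc)
      have "real (Suc k) / real n = real k / real n + 1 / real n" for k
        by (simp add: add_divide_distrib)
      then have "\<bar>s - real i / real n\<bar> \<le> 1 / real n" "\<bar>t - real j / real n\<bar> \<le> 1 / real n"
        using s t by auto
      then have "dist (s, t) ?z \<le> 1 / real n + 1 / real n"
        using sqrt_sum_squares_le_sum_abs[of "s - real i / real n" "t - real j / real n"]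
        by (simp add: dist_Pair_Pair dist_real_def)
      also have "\<dots> < \<delta>"
        using n \<delta>(1) pos by (simp add: field_simps)
      finally have "dist (h (s, t)) (h ?z) < 1 / real (card V)"
        by (rule \<delta>(2)[OF z \<open>(s, t) \<in> ?K\<close>])
      then have "0 < Poly_Mapping.lookup (h (s, t)) v"
        using v abs_lookup_diff_le_dist[of "h (s, t)" v "h ?z"] by linarith
      then show ?thesis
        by (simp add: in_keys_iff)
    qed
    then show "\<exists>v. \<forall>s\<in>{real i / real n..real (Suc i) / real n}.
       \<forall>t\<in>{real j / real n..real (Suc j) / real n}. v \<in> Poly_Mapping.keys (h (s, t))"
      by blast
  qed
qed

text \<open>A path is regarded as a homotopy constant in its first parameter; one row of cells gives
  the subdivision.\<close>

lemma star_fine_exists: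
  assumes "path p" "path_image p \<subseteq> X"
  shows "\<exists>n. star_fine n p"
proof -
  have "continuous_on ({0..1} \<times> {0..1}) (\<lambda>z. p (snd z))"
    by (rule continuous_on_compose2[OF assms(1)[unfolded path_def] continuous_on_snd[OF continuous_on_id]])
      auto
  moreover have "(\<lambda>z. p (snd z)) \<in> {0..1} \<times> {0..1} \<rightarrow> X"
    using assms(2) by (auto simp: path_image_def)
  ultimately obtain n where n: "0 < n"
    "\<And>i j. i < n \<Longrightarrow> j < n \<Longrightarrow> \<exists>v. \<forall>s\<in>{real i / real n..real (Suc i) / real n}.
       \<forall>t\<in>{real j / real n..real (Suc j) / real n}. v \<in> Poly_Mapping.keys (p t)"
    by (rule star_fine_grid) (simp only: snd_conv)
  have "0 \<in> {real 0 / real n..real (Suc 0) / real n}"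
    by simp
  then have "\<exists>v. \<forall>t\<in>{real j / real n..real (Suc j) / real n}. v \<in> Poly_Mapping.keys (p t)" if "j < n" for j
    using n(2)[OF n(1) that] by blast
  then show ?thesis
    using n(1) by (auto simp: star_fine_def)
qed

text \<open>Guaranteed to be a walk for star-fine subdivisions. Otherwise consecutive carriers may
  be disjoint, and \<open>tr\<close> then picks from an empty set of paths.\<close>

definition hol :: "nat \<Rightarrow> (real \<Rightarrow> 'v \<Rightarrow>\<^sub>0 real) \<Rightarrow> ('v set \<times> 'v set + 'v set \<times> 'v set) list" where
  "hol n p = gw (\<lambda>j. Poly_Mapping.keys (p (real j / real n))) n"

lemma keys_path_in_complex:
  assumes "path_image p \<subseteq> X" "j \<le> n"
  shows "Poly_Mapping.keys (p (real j / real n)) \<in> S - {{}}"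
proof -
  have "real j / real n \<in> {0..1}"
    using assms(2) by (auto simp: divide_le_eq_1)
  then show ?thesis
    using assms(1) by (intro keys_in_complex) (auto simp: path_image_def)
qed

lemma walks_hol:
  assumes "star_fine n p" "path_image p \<subseteq> X"
  shows "(Poly_Mapping.keys (pathstart p), hol n p, Poly_Mapping.keys (pathfinish p)) \<in> walks Q"
proof -
  let ?s = "\<lambda>j. Poly_Mapping.keys (p (real j / real n))"
  have "?s j \<inter> ?s (Suc j) \<noteq> {}" if j: "j < n" for j
  proof -
    obtain v where "\<forall>t\<in>{real j / real n..real (Suc j) / real n}. v \<in> Poly_Mapping.keys (p t)"
      using assms(1) j unfolding star_fine_def by blast
    moreover have "real j / real n \<le> real (Suc j) / real n"
      by (simp add: divide_right_mono)
    ultimately have "v \<in> ?s j \<inter> ?s (Suc j)"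
      unfolding Int_iff by (intro conjI) (drule bspec; simp)+
    then show ?thesis
      by blast
  qed
  then have "(?s 0, hol n p, ?s n) \<in> walks Q"
    unfolding hol_def using keys_path_in_complex[OF assms(2)] by (intro walks_gw) auto
  then show ?thesis
    using assms(1) by (simp add: star_fine_def pathstart_def pathfinish_def)
qed

lemma weq_hol_refine:
  assumes p: "star_fine n p" "path_image p \<subseteq> X" and m: "0 < m"
  shows "weq (Poly_Mapping.keys (pathstart p)) (Poly_Mapping.keys (pathfinish p)) (hol (n * m) p) (hol n p)"
proof -
  let ?s = "\<lambda>j. Poly_Mapping.keys (p (real j / real (n * m)))"
  have n: "0 < n"
    using p by (simp add: star_fine_def)
  have "\<exists>v. \<forall>i\<le>m. v \<in> ?s (j * m + i)" if j: "j < n" for j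
  proof -
    obtain v where v: "\<forall>t\<in>{real j / real n..real (Suc j) / real n}. v \<in> Poly_Mapping.keys (p t)"
      using p(1) j unfolding star_fine_def by blast
    have "real (j * m + i) / real (n * m) \<in> {real j / real n..real (Suc j) / real n}" if "i \<le> m" for i
      using that n m by (simp add: field_simps)
    then show ?thesis
      using v by blast
  qed
  then have "weq (?s 0) (?s (n * m)) (gw ?s (n * m)) (gw (\<lambda>j. ?s (j * m)) n)"
    by (intro weq_gw_refine keys_path_in_complex[OF p(2)])
  moreover have "gw (\<lambda>j. ?s (j * m)) n = hol n p"
    using m by (simp add: hol_def)
  ultimately show ?thesis
    using n m by (simp add: hol_def pathstart_def pathfinish_def)
qed

text \<open>The subdivision into \<open>n * m\<close> pieces refines both, so the class of the walk
  depends on the path alone.\<close>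

lemma weq_hol_hol:
  assumes "star_fine n p" "star_fine m p" "path_image p \<subseteq> X"
  shows "weq (Poly_Mapping.keys (pathstart p)) (Poly_Mapping.keys (pathfinish p)) (hol n p) (hol m p)"
proof -
  have "0 < n" "0 < m"
    using assms by (auto simp: star_fine_def)
  then show ?thesis
    using weq_trans[OF weq_sym[OF weq_hol_refine[of n p m]] weq_hol_refine[of m p n, unfolded mult.commute[of m n]]] assms
    by simp
qed

text \<open>An equality of lists and not just an equivalence, because both paths are cut into the
  same number of pieces.\<close>

lemma hol_join:
  assumes "0 < n" and pq: "pathfinish p = pathstart q"
  shows "hol (2 * n) (p +++ q) = hol n p @ hol n q"
proof -
  let ?s = "\<lambda>j. Poly_Mapping.keys ((p +++ q) (real j / real (2 * n)))"
  have n: "0 < real n"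
    using assms by simp
  have "hol (2 * n) (p +++ q) = gw ?s n @ gw (\<lambda>j. ?s (n + j)) n"
    unfolding hol_def by (subst gw_add[symmetric]) (simp only: mult_2)
  also have "gw ?s n = hol n p"
    unfolding hol_def
  proof (rule gw_cong)
    fix j assume "j \<le> n"
    then have "real j / real (2 * n) \<le> 1 / 2" "2 * (real j / real (2 * n)) = real j / real n"
      using n by (simp_all add: field_simps)
    then show "?s j = Poly_Mapping.keys (p (real j / real n))"
      by (simp only: joinpaths_def if_True)
  qed
  also have "gw (\<lambda>j. ?s (n + j)) n = hol n q"
    unfolding hol_def
  proof (rule gw_cong)
    fix j assume "j \<le> n"
    show "?s (n + j) = Poly_Mapping.keys (q (real j / real n))"
    proof (cases "j = 0")
      case True
      then show ?thesis
        using n pq by (simp add: joinpaths_def pathstart_def pathfinish_def)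
    next
      case False
      then have "\<not> real (n + j) / real (2 * n) \<le> 1 / 2" "2 * (real (n + j) / real (2 * n)) - 1 = real j / real n"
        using n by (simp_all add: field_simps)
      then show ?thesis
        by (simp only: joinpaths_def if_False)
    qed
  qed
  finally show ?thesis .
qed

text \<open>Neighbouring rows of the grid form a ladder whose squares are the cells. The homotopy
  fixes the ends, so the outer rungs are transports of a simplex to itself and disappear. One
  \<open>n\<close> serves both paths, as they are opposite edges of the same grid.\<close>

lemma weq_hol_homotopic:
  assumes "homotopic_paths X p q"
  obtains n where "star_fine n p" "star_fine n q"
    "weq (Poly_Mapping.keys (pathstart p)) (Poly_Mapping.keys (pathfinish p)) (hol n p) (hol n q)"
proof -
  obtain h :: "real \<times> real \<Rightarrow> 'v \<Rightarrow>\<^sub>0 real"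
    where cont: "continuous_on ({0..1} \<times> {0..1}) h" and h: "h \<in> {0..1} \<times> {0..1} \<rightarrow> X"
    and h01: "\<forall>t\<in>{0..1}. h (0, t) = p t" "\<forall>t\<in>{0..1}. h (1, t) = q t"
    and "\<forall>s\<in>{0..1}. pathstart (h \<circ> Pair s) = pathstart p \<and> pathfinish (h \<circ> Pair s) = pathfinish p"
    using assms unfolding homotopic_paths by blast
  then have ends: "h (s, 0) = pathstart p" "h (s, 1) = pathfinish p" if "s \<in> {0..1}" for s
    using that by (simp_all add: pathstart_def pathfinish_def)
  have h0: "h (0, t) = p t" and h1: "h (1, t) = q t" if "t \<in> {0..1}" for t
    using h01 that by blast+
  obtain n where n: "0 < n"
    and grid: "\<And>i j. i < n \<Longrightarrow> j < n \<Longrightarrow> \<exists>v. \<forall>s\<in>{real i / real n..real (Suc i) / real n}.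
       \<forall>t\<in>{real j / real n..real (Suc j) / real n}. v \<in> Poly_Mapping.keys (h (s, t))"
    by (rule star_fine_grid[OF cont h]) (rule that)
  have unit: "real k / real n \<in> {0..1}" if "k \<le> n" for k
    using that n by simp
  have step: "real k / real n \<in> {real k / real n..real (Suc k) / real n}"
    "real (Suc k) / real n \<in> {real k / real n..real (Suc k) / real n}" for k
    by (simp_all add: divide_right_mono)
  have sub: "{real k / real n..real (Suc k) / real n} \<subseteq> {0..1}" if "k < n" for k
    using unit[of k] unit[of "Suc k"] that by (auto simp del: of_nat_Suc)
  let ?s = "\<lambda>i j. Poly_Mapping.keys (h (real i / real n, real j / real n))"
  have S: "?s i j \<in> S - {{}}" if "i \<le> n" "j \<le> n" for i j
    using h unit that by (intro keys_in_complex) blast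
  have s0: "?s i 0 = Poly_Mapping.keys (pathstart p)" "?s i n = Poly_Mapping.keys (pathfinish p)" if "i \<le> n" for i
    using ends unit[OF that] n by simp_all
  let ?a = "Poly_Mapping.keys (pathstart p)" and ?b = "Poly_Mapping.keys (pathfinish p)"
  have row: "weq ?a ?b (gw (?s i) n) (gw (?s (Suc i)) n)" if i: "i < n" for i
  proof -
    have cell: "?s i j \<inter> ?s i (Suc j) \<inter> ?s (Suc i) j \<inter> ?s (Suc i) (Suc j) \<noteq> {}" if j: "j < n" for j
    proof -
      obtain v where "\<forall>s\<in>{real i / real n..real (Suc i) / real n}.
         \<forall>t\<in>{real j / real n..real (Suc j) / real n}. v \<in> Poly_Mapping.keys (h (s, t))"
        using grid[OF i j] by blast
      then have "v \<in> ?s i j \<inter> ?s i (Suc j) \<inter> ?s (Suc i) j \<inter> ?s (Suc i) (Suc j)"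
        using step by blast
      then show ?thesis
        by blast
    qed
    have w: "(?s k 0, gw (?s k) n, ?s k n) \<in> walks Q" if k: "k = i \<or> k = Suc i" for k
    proof (rule walks_gw)
      show "?s k j \<in> S - {{}}" if "j \<le> n" for j
        using S[of k j] that k i by linarith
      show "?s k j \<inter> ?s k (Suc j) \<noteq> {}" if "j < n" for j
        using k cell[OF that] by (elim disjE) (simp only:, blast)+
    qed
    have ab: "?a \<in> S" "?a \<noteq> {}" "?b \<in> S" "?b \<noteq> {}"
      using S[of 0 0] S[of 0 n] s0[of 0] by auto
    have "weq (?s i 0) (?s (Suc i) n) (gw (?s i) n @ tr (?s i n) (?s (Suc i) n))
        (tr (?s i 0) (?s (Suc i) 0) @ gw (?s (Suc i)) n)"
    proof (rule weq_gw_ladder)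
      show "?s i j \<in> S" "?s (Suc i) j \<in> S" if "j \<le> n" for j
        using S[of i j] S[of "Suc i" j] that i by simp_all
      show "?s i 0 \<inter> ?s (Suc i) 0 \<noteq> {}"
        using ab i by (simp only: s0 Suc_leI less_imp_le) simp
    qed (rule cell)
    then have *: "weq ?a ?b (gw (?s i) n @ tr ?b ?b) (tr ?a ?a @ gw (?s (Suc i)) n)"
      by (simp only: s0[OF less_imp_le[OF i]] s0[OF Suc_leI[OF i]])
    have wi: "(?a, gw (?s i) n, ?b) \<in> walks Q" "(?a, gw (?s (Suc i)) n, ?b) \<in> walks Q"
      using w[of i] w[of "Suc i"] by (simp_all only: s0[OF less_imp_le[OF i]] s0[OF Suc_leI[OF i]] simp_thms)
    have "weq ?a ?b (gw (?s i) n @ []) (gw (?s i) n @ tr ?b ?b)"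
      by (intro weq_append[OF weq_refl[OF wi(1)]] weq_sym[OF weq_tr_refl] ab)
    also note *
    also have "weq ?a ?b (tr ?a ?a @ gw (?s (Suc i)) n) ([] @ gw (?s (Suc i)) n)"
      by (intro weq_append[OF _ weq_refl[OF wi(2)]] weq_tr_refl ab)
    finally show ?thesis
      by simp
  qed
  have rows: "weq ?a ?b (gw (?s 0) n) (gw (?s i) n)" if "i \<le> n" for i
    using that
  proof (induction i)
    case 0
    show ?case
      by (rule weq_refl[OF weq_walks(1)[OF row[OF n]]])
  next
    case (Suc i)
    then show ?case
      using weq_trans[OF Suc.IH row[of i]] by simp
  qed
  show thesis
  proof
    show "star_fine n p"
      unfolding star_fine_def
    proof (intro conjI allI impI n)
      fix j assume j: "j < n"
      obtain v where v: "\<forall>s\<in>{real 0 / real n..real (Suc 0) / real n}.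
         \<forall>t\<in>{real j / real n..real (Suc j) / real n}. v \<in> Poly_Mapping.keys (h (s, t))"
        using grid[OF n j] by blast
      have "v \<in> Poly_Mapping.keys (p t)" if "t \<in> {real j / real n..real (Suc j) / real n}" for t
        using bspec[OF bspec[OF v step(1)] that] by (simp add: h0[OF subsetD[OF sub[OF j] that]])
      then show "\<exists>v. \<forall>t\<in>{real j / real n..real (Suc j) / real n}. v \<in> Poly_Mapping.keys (p t)"
        by blast
    qed
    show "star_fine n q"
      unfolding star_fine_def
    proof (intro conjI allI impI n)
      fix j assume j: "j < n"
      \<comment> \<open>The path \<open>q\<close> sits at parameter \<open>1 = n / n\<close>, the
        far side of the last row of cells, whose index is \<open>n - 1\<close>.\<close>
      have n': "n - 1 < n" "Suc (n - 1) = n"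
        using n by simp_all
      obtain v where v: "\<forall>s\<in>{real (n - 1) / real n..real (Suc (n - 1)) / real n}.
         \<forall>t\<in>{real j / real n..real (Suc j) / real n}. v \<in> Poly_Mapping.keys (h (s, t))"
        using grid[OF n'(1) j] by blast
      have "v \<in> Poly_Mapping.keys (q t)" if "t \<in> {real j / real n..real (Suc j) / real n}" for t
        using bspec[OF bspec[OF v step(2)] that] n unfolding n'(2)
        by (simp add: h1[OF subsetD[OF sub[OF j] that]])
      then show "\<exists>v. \<forall>t\<in>{real j / real n..real (Suc j) / real n}. v \<in> Poly_Mapping.keys (q t)"
        by blast
    qed
    have "gw (?s 0) n = hol n p" "gw (?s n) n = hol n q"
      unfolding hol_def using h0 h1 unit n by (auto intro!: gw_cong)
    then show "weq ?a ?b (hol n p) (hol n q)"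
      using rows[of n] by simp
  qed
qed

end

section \<open>Realizing walks by paths\<close>

lemma lookup_scaleR:
  "Poly_Mapping.lookup (r *\<^sub>R x) v = r *\<^sub>R Poly_Mapping.lookup x v"
proof -
  have "finite {v. r *\<^sub>R Poly_Mapping.lookup x v \<noteq> 0}"
    by (rule finite_subset[OF _ finite_keys[of x]]) (auto simp: in_keys_iff)
  then show ?thesis
    by (simp add: scaleR_poly_mapping_def Abs_poly_mapping_inverse)
qed

lemma convex_closed_simplex: "finite \<sigma> \<Longrightarrow> convex (closed_simplex \<sigma>)"
  unfolding convex_alt
proof (intro ballI allI impI, elim conjE)
  fix x y :: "'a \<Rightarrow>\<^sub>0 real" and u :: real
  assume \<sigma>: "finite \<sigma>" and xy: "x \<in> closed_simplex \<sigma>" "y \<in> closed_simplex \<sigma>" and u: "0 \<le> u" "u \<le> 1"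
  have sum: "(\<Sum>v\<in>Poly_Mapping.keys z. Poly_Mapping.lookup z v) = (\<Sum>v\<in>\<sigma>. Poly_Mapping.lookup z v)"
    if "Poly_Mapping.keys z \<subseteq> \<sigma>" for z :: "'a \<Rightarrow>\<^sub>0 real"
    using \<sigma> that by (intro sum.mono_neutral_left) (auto simp: in_keys_iff)
  let ?z = "(1 - u) *\<^sub>R x + u *\<^sub>R y"
  have lookup: "Poly_Mapping.lookup ?z v = (1 - u) * Poly_Mapping.lookup x v + u * Poly_Mapping.lookup y v" for v
    by (simp add: Poly_Mapping.lookup_add lookup_scaleR)
  have "Poly_Mapping.keys x \<subseteq> \<sigma>" "Poly_Mapping.keys y \<subseteq> \<sigma>"
    using xy by (auto simp: closed_simplex_def)
  then have "Poly_Mapping.lookup x v = 0 \<and> Poly_Mapping.lookup y v = 0" if "v \<notin> \<sigma>" for v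
    using that by (auto simp: in_keys_iff)
  then have "Poly_Mapping.lookup ?z v = 0" if "v \<notin> \<sigma>" for v
    using that by (simp add: lookup)
  then have keys: "Poly_Mapping.keys ?z \<subseteq> \<sigma>"
    by (metis in_keys_iff subsetI)
  have "(\<Sum>v\<in>\<sigma>. Poly_Mapping.lookup x v) = 1" "(\<Sum>v\<in>\<sigma>. Poly_Mapping.lookup y v) = 1"
    using xy sum by (auto simp: closed_simplex_def)
  then have "(\<Sum>v\<in>\<sigma>. Poly_Mapping.lookup ?z v) = 1"
    by (simp add: lookup sum.distrib flip: sum_distrib_left)
  moreover have "0 \<le> Poly_Mapping.lookup ?z v" for v
    using xy u by (simp add: lookup closed_simplex_def)
  ultimately show "?z \<in> closed_simplex \<sigma>"
    using keys sum[OF keys] by (simp add: closed_simplex_def)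
qed

definition barycenter :: "'v set \<Rightarrow> 'v \<Rightarrow>\<^sub>0 real" where
  "barycenter \<sigma> = (\<Sum>v\<in>\<sigma>. Poly_Mapping.single v (1 / real (card \<sigma>)))"

lemma lookup_barycenter:
  "finite \<sigma> \<Longrightarrow> Poly_Mapping.lookup (barycenter \<sigma>) v = (if v \<in> \<sigma> then 1 / real (card \<sigma>) else 0)"
  by (simp add: barycenter_def Poly_Mapping.lookup_sum Poly_Mapping.lookup_single when_def)

lemma keys_barycenter: "finite \<sigma> \<Longrightarrow> Poly_Mapping.keys (barycenter \<sigma>) = \<sigma>"
  by (auto simp: in_keys_iff lookup_barycenter card_eq_0_iff split: if_splits)

text \<open>Starlike sets are simply connected. The geometric homotopies below come from here, with
  \<open>T\<close> a closed simplex or the star of a vertex.\<close>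

lemma homotopic_paths_starlike:
  fixes T X :: "'a::real_normed_vector set"
  assumes "starlike T" "T \<subseteq> X" "path p" "path_image p \<subseteq> T" "path q" "path_image q \<subseteq> T"
    "pathstart q = pathstart p" "pathfinish q = pathfinish p"
  shows "homotopic_paths X p q"
proof -
  have "homotopic_paths T p q"
    using starlike_imp_simply_connected[OF assms(1)] assms by (auto simp: simply_connected_eq_homotopic_paths)
  then show ?thesis
    using assms(2) by (rule homotopic_paths_subset)
qed

context complex_quiver
begin

lemma closed_simplex_subset_realization: "\<sigma> \<in> S \<Longrightarrow> closed_simplex \<sigma> \<subseteq> X"
  by (auto simp: geometric_realization_def)

lemma in_closed_simplex: "x \<in> X \<Longrightarrow> Poly_Mapping.keys x \<subseteq> \<sigma> \<Longrightarrow> x \<in> closed_simplex \<sigma>"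
  by (auto simp: in_realization_iff closed_simplex_def)

lemma barycenter_in_closed_simplex:
  assumes "\<sigma> \<subseteq> \<tau>" "\<sigma> \<noteq> {}" "\<tau> \<in> S"
  shows "barycenter \<sigma> \<in> closed_simplex \<tau>"
proof -
  have "finite \<sigma>"
    using assms finite_simplex finite_subset by blast
  then show ?thesis
    using assms by (simp add: closed_simplex_def keys_barycenter lookup_barycenter)
qed

lemma barycenter_in_realization: "\<sigma> \<in> S - {{}} \<Longrightarrow> barycenter \<sigma> \<in> X"
  using barycenter_in_closed_simplex closed_simplex_subset_realization by blast

lemma keys_barycenter_simplex [simp]: "\<sigma> \<in> S \<Longrightarrow> Poly_Mapping.keys (barycenter \<sigma>) = \<sigma>"
  by (simp add: keys_barycenter finite_simplex)

lemma path_image_linepath_closed_simplex: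
  assumes "x \<in> closed_simplex \<sigma>" "y \<in> closed_simplex \<sigma>" "\<sigma> \<in> S"
  shows "path_image (linepath x y) \<subseteq> closed_simplex \<sigma>"
  using assms convex_closed_simplex[OF finite_simplex] by (simp add: closed_segment_subset)

text \<open>Coordinates are affine along a segment, so one that is positive at both ends is positive
  throughout.\<close>

lemma star_fine_linepath:
  assumes x: "x \<in> X" and y: "y \<in> X" and v: "v \<in> Poly_Mapping.keys x" "v \<in> Poly_Mapping.keys y"
  shows "star_fine 1 (linepath x y)"
proof -
  have pos: "0 < Poly_Mapping.lookup x v" "0 < Poly_Mapping.lookup y v"
    using x y v by (auto simp: in_realization_iff in_keys_iff less_le)
  have "v \<in> Poly_Mapping.keys (linepath x y t)" if "t \<in> {0..1}" for t
  proof -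
    have "0 < (1 - t) * Poly_Mapping.lookup x v + t * Poly_Mapping.lookup y v"
      using that pos by (cases "t = 0") (auto intro: add_nonneg_pos)
    then show ?thesis
      by (simp add: linepath_def in_keys_iff Poly_Mapping.lookup_add lookup_scaleR)
  qed
  then show ?thesis
    unfolding star_fine_def by (auto intro!: exI[of _ v])
qed

lemma hol_linepath: "hol 1 (linepath x y) = tr (Poly_Mapping.keys x) (Poly_Mapping.keys y)"
  by (simp add: hol_def gw_def linepath_def)

text \<open>The term \<open>case_sum snd fst a\<close> is where the step ends: the head of an arrow,
  the tail for a formal inverse.\<close>

lemma walks_Cons_cases:
  assumes "(\<sigma>, a # w, \<tau>) \<in> walks Q"
  obtains \<rho> where "(\<sigma>, [a], \<rho>) \<in> walks Q" "(\<rho>, w, \<tau>) \<in> walks Q" "\<rho> = case_sum snd fst a"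
  using assms walks_verts(1) by (cases a) (auto simp: walks_simps)

text \<open>The ends of an arrow are comparable, so their intersection is the smaller one. One leg
  of the transport is then trivial and the other is equivalent to the arrow or its inverse.\<close>

lemma walks_arrow:
  assumes "(\<sigma>, [a], \<rho>) \<in> walks Q"
  shows "\<sigma> \<in> S - {{}}" "\<rho> \<in> S - {{}}" "\<sigma> \<subseteq> \<rho> \<or> \<rho> \<subseteq> \<sigma>" "weq \<sigma> \<rho> (tr \<sigma> \<rho>) [a]"
proof -
  show S: "\<sigma> \<in> S - {{}}" "\<rho> \<in> S - {{}}"
    using walks_verts[OF assms] by (simp_all add: verts_Q)
  have "\<sigma> \<subseteq> \<rho> \<and> weq \<sigma> \<rho> (tr \<sigma> \<rho>) [a] \<or> \<rho> \<subseteq> \<sigma> \<and> weq \<sigma> \<rho> (tr \<sigma> \<rho>) [a]"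
  proof (cases a)
    case (Inl e)
    then have e: "e = (\<sigma>, \<rho>)" "(\<sigma>, \<rho>) \<in> arcs Q"
      using assms by (auto simp: walks_simps)
    then have sub: "\<sigma> \<subseteq> \<rho>"
      using arcs_Q by blast
    have "(\<sigma>, [e], \<rho>) \<in> paths Q"
      using e S by (simp add: paths_def awalk_Cons_iff awalk_Nil_iff verts_Q)
    then have "weq \<sigma> \<rho> (up \<sigma> \<rho>) [a]"
      using weq_up[of \<sigma> \<rho> "[e]"] sub S Inl by simp
    moreover have "weq \<sigma> \<sigma> (wrev (up \<sigma> \<sigma>)) (wrev [])"
      using S by (intro weq_wrev weq_up_refl) auto
    ultimately have "weq \<sigma> \<rho> (wrev (up \<sigma> \<sigma>) @ up \<sigma> \<rho>) (wrev [] @ [a])"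
      by (intro weq_append)
    moreover have "weq \<sigma> \<rho> (tr \<sigma> \<rho>) (wrev (up \<sigma> \<sigma>) @ up \<sigma> \<rho>)"
      using S sub by (intro weq_tr) auto
    ultimately show ?thesis
      using sub by (auto intro: weq_trans)
  next
    case (Inr e)
    then have e: "e = (\<rho>, \<sigma>)" "(\<rho>, \<sigma>) \<in> arcs Q"
      using assms by (auto simp: walks_simps)
    then have sub: "\<rho> \<subseteq> \<sigma>"
      using arcs_Q by blast
    have "(\<rho>, [e], \<sigma>) \<in> paths Q"
      using e S by (simp add: paths_def awalk_Cons_iff awalk_Nil_iff verts_Q)
    then have "weq \<sigma> \<rho> (wrev (up \<rho> \<sigma>)) (wrev [Inl e])"
      using weq_wrev[OF weq_up[of \<rho> \<sigma> "[e]"]] sub S by simp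
    moreover have "weq \<rho> \<rho> (up \<rho> \<rho>) []"
      using S by (intro weq_up_refl) auto
    ultimately have "weq \<sigma> \<rho> (wrev (up \<rho> \<sigma>) @ up \<rho> \<rho>) (wrev [Inl e] @ [])"
      by (intro weq_append)
    moreover have "weq \<sigma> \<rho> (tr \<sigma> \<rho>) (wrev (up \<rho> \<sigma>) @ up \<rho> \<rho>)"
      using S sub by (intro weq_tr) auto
    moreover have "wrev [Inl e] @ [] = [a]"
      by (simp add: wrev_def Inr)
    ultimately show ?thesis
      using sub by (auto intro: weq_trans)
  qed
  then show "\<sigma> \<subseteq> \<rho> \<or> \<rho> \<subseteq> \<sigma>" "weq \<sigma> \<rho> (tr \<sigma> \<rho>) [a]"
    by blast+
qed

text \<open>Each arrow is realized by a segment to the barycenter of the next simplex. The start may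
  be any point with the right carrier: the induction restarts at a barycenter, whereas the
  application needs an arbitrary base point.\<close>

lemma hol_surj:
  assumes "(\<sigma>, w, \<tau>) \<in> walks Q" "x \<in> X" "Poly_Mapping.keys x = \<sigma>" "y \<in> X" "Poly_Mapping.keys y = \<tau>"
  shows "\<exists>p n. path p \<and> path_image p \<subseteq> X \<and> pathstart p = x \<and> pathfinish p = y \<and> star_fine n p \<and>
    weq \<sigma> \<tau> (hol n p) w"
  using assms
proof (induction w arbitrary: \<sigma> x)
  case Nil
  have \<sigma>: "\<sigma> = \<tau>" "\<sigma> \<in> S - {{}}"
    using Nil walks_verts(1)[OF Nil(1)] by (simp_all add: walks_simps verts_Q)
  then obtain v where "v \<in> \<sigma>"
    by blast
  then have "star_fine 1 (linepath x y)"
    using Nil \<sigma> by (intro star_fine_linepath) auto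
  moreover have "path_image (linepath x y) \<subseteq> closed_simplex \<sigma>"
    using Nil \<sigma> by (intro path_image_linepath_closed_simplex in_closed_simplex) auto
  then have "path_image (linepath x y) \<subseteq> X"
    using closed_simplex_subset_realization \<sigma> by blast
  moreover have "weq \<sigma> \<tau> (hol 1 (linepath x y)) []"
    using Nil \<sigma> weq_tr_refl by (simp add: hol_linepath del: One_nat_def)
  ultimately show ?case
    by (intro exI[of _ "linepath x y"] exI[of _ 1]) simp
next
  case (Cons a w)
  then obtain \<rho> where a: "(\<sigma>, [a], \<rho>) \<in> walks Q" and w: "(\<rho>, w, \<tau>) \<in> walks Q"
    using walks_Cons_cases by metis
  note arrow = walks_arrow[OF a]
  let ?z = "barycenter \<rho>"
  have z: "?z \<in> X" "Poly_Mapping.keys ?z = \<rho>"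
    using arrow barycenter_in_realization by auto
  obtain q n where q: "path q" "path_image q \<subseteq> X" "pathstart q = ?z" "pathfinish q = y" "star_fine n q"
    "weq \<rho> \<tau> (hol n q) w"
    using Cons.IH[OF w z Cons.prems(4,5)] by blast
  let ?l = "linepath x ?z"
  have n: "0 < n"
    using q by (simp add: star_fine_def)
  obtain v where "v \<in> \<sigma>" "v \<in> \<rho>"
    using arrow by blast
  then have l1: "star_fine 1 ?l"
    using Cons.prems z by (intro star_fine_linepath) auto
  \<comment> \<open>The segment is cut into \<open>n\<close> pieces only to match \<open>q\<close>,
    as \<open>hol_join\<close> requires equally many on both sides.\<close>
  then have ln: "star_fine n ?l"
    using star_fine_mult[OF l1 n] by simp
  have "\<sigma> \<union> \<rho> \<in> S"
    using arrow by (auto simp: Un_absorb1 Un_absorb2)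
  then have "path_image ?l \<subseteq> closed_simplex (\<sigma> \<union> \<rho>)" "closed_simplex (\<sigma> \<union> \<rho>) \<subseteq> X"
    using Cons.prems z
    by (intro path_image_linepath_closed_simplex in_closed_simplex closed_simplex_subset_realization; simp)+
  then have l: "path_image ?l \<subseteq> X"
    by blast
  have "weq \<sigma> \<rho> (hol n ?l) (hol 1 ?l)"
    using weq_hol_hol[OF ln l1 l] Cons.prems z by simp
  also have "weq \<sigma> \<rho> (hol 1 ?l) [a]"
    using arrow(4) Cons.prems z by (simp add: hol_linepath del: One_nat_def)
  finally have "weq \<sigma> \<tau> (hol (2 * n) (?l +++ q)) ([a] @ w)"
    using weq_append[OF _ q(6), of \<sigma> "hol n ?l" "[a]"] hol_join[OF n, of ?l q] q by simp
  moreover have "star_fine (2 * n) (?l +++ q)"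
    using star_fine_join[OF ln q(5)] q by simp
  ultimately show ?case
    using q l by (intro exI[of _ "?l +++ q"] exI[of _ "2 * n"]) (simp add: path_image_join)
qed

text \<open>The recursion carries the current simplex and reads the next one off the arrow, so the
  segments fit together for every list, walk or not.\<close>

primrec wpath :: "'v set \<Rightarrow> ('v set \<times> 'v set + 'v set \<times> 'v set) list \<Rightarrow> real \<Rightarrow> 'v \<Rightarrow>\<^sub>0 real" where
  "wpath \<sigma> [] = linepath (barycenter \<sigma>) (barycenter \<sigma>)"
| "wpath \<sigma> (a # w) =
     linepath (barycenter \<sigma>) (barycenter (case_sum snd fst a)) +++ wpath (case_sum snd fst a) w"

lemma pathstart_wpath [simp]: "pathstart (wpath \<sigma> w) = barycenter \<sigma>"
  by (cases w) simp_all

lemma pathfinish_wpath: "(\<sigma>, w, \<tau>) \<in> walks Q \<Longrightarrow> pathfinish (wpath \<sigma> w) = barycenter \<tau>"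
proof (induction w arbitrary: \<sigma>)
  case (Cons a w)
  show ?case
    by (rule walks_Cons_cases[OF Cons.prems]) (simp add: Cons.IH)
qed (simp add: walks_simps)

lemma path_wpath [simp]: "path (wpath \<sigma> w)"
  by (induction w arbitrary: \<sigma>) simp_all

text \<open>Both ends of a segment are barycenters of faces of the larger end of its arrow, so by
  convexity the segment stays in that closed simplex. The set \<open>T\<close> is kept general to
  serve for the realization, a closed simplex and a star.\<close>

lemma path_image_wpath_arrows:
  assumes "(\<sigma>, w, \<tau>) \<in> walks Q" "barycenter \<sigma> \<in> T"
    and "\<And>a e. a \<in> set w \<Longrightarrow> a = Inl e \<or> a = Inr e \<Longrightarrow> e \<in> arcs Q \<Longrightarrow> closed_simplex (snd e) \<subseteq> T"
  shows "path_image (wpath \<sigma> w) \<subseteq> T"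
  using assms
proof (induction w arbitrary: \<sigma>)
  case (Cons a w)
  from Cons.prems(1) obtain \<rho> where a: "(\<sigma>, [a], \<rho>) \<in> walks Q" and w: "(\<rho>, w, \<tau>) \<in> walks Q"
    and \<rho>: "\<rho> = case_sum snd fst a"
    by (rule walks_Cons_cases)
  obtain e where ae: "a = Inl e \<or> a = Inr e"
    by (cases a) auto
  then have e: "e \<in> arcs Q" "{\<sigma>, \<rho>} = {fst e, snd e}"
    using a by (auto simp: walks_simps)
  then have *: "fst e \<noteq> {}" "fst e \<subseteq> snd e" "snd e \<in> S"
    using arcs_Q[of "fst e" "snd e"] by auto
  have b: "barycenter \<sigma> \<in> closed_simplex (snd e)" "barycenter \<rho> \<in> closed_simplex (snd e)"
    using e(2) * barycenter_in_closed_simplex[of "fst e" "snd e"] barycenter_in_closed_simplex[of "snd e" "snd e"]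
    by (auto simp: doubleton_eq_iff)
  moreover have "closed_simplex (snd e) \<subseteq> T"
    using Cons.prems(3)[OF _ ae e(1)] by simp
  ultimately have "path_image (linepath (barycenter \<sigma>) (barycenter \<rho>)) \<subseteq> T" "barycenter \<rho> \<in> T"
    using path_image_linepath_closed_simplex[OF b *(3)] by blast+
  moreover have "path_image (wpath \<rho> w) \<subseteq> T"
    using Cons.IH[OF w \<open>barycenter \<rho> \<in> T\<close>] Cons.prems(3) by auto
  ultimately show ?case
    using path_image_join_subset[of "linepath (barycenter \<sigma>) (barycenter \<rho>)" "wpath \<rho> w"] by (auto simp: \<rho>)
qed simp

lemma path_image_wpath:
  assumes "(\<sigma>, w, \<tau>) \<in> walks Q"
  shows "path_image (wpath \<sigma> w) \<subseteq> X"
proof (rule path_image_wpath_arrows[OF assms])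
  show "barycenter \<sigma> \<in> X"
    using walks_verts(1)[OF assms] by (intro barycenter_in_realization) (simp add: verts_Q)
  show "closed_simplex (snd e) \<subseteq> X" if "e \<in> arcs Q" for e
    using arcs_Q[of "fst e" "snd e"] that by (intro closed_simplex_subset_realization) simp
qed

text \<open>Both sides trace the same polygon; joining paths is associative and unital only up to
  homotopy.\<close>

lemma homotopic_wpath_append:
  assumes "(\<sigma>, p, \<rho>) \<in> walks Q" "(\<rho>, q, \<tau>) \<in> walks Q"
  shows "homotopic_paths X (wpath \<sigma> (p @ q)) (wpath \<sigma> p +++ wpath \<rho> q)"
  using assms(1)
proof (induction p arbitrary: \<sigma>)
  case Nil
  then have "\<sigma> = \<rho>"
    by (simp add: walks_simps)
  then show ?case
    using homotopic_paths_sym[OF homotopic_paths_lid'[of "wpath \<rho> q" X "barycenter \<rho>"]]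
      path_image_wpath[OF assms(2)] by (simp add: linepath_refl)
next
  case (Cons a p)
  from Cons.prems obtain \<mu> where a: "(\<sigma>, [a], \<mu>) \<in> walks Q" and p: "(\<mu>, p, \<rho>) \<in> walks Q"
    and \<mu>: "\<mu> = case_sum snd fst a"
    by (rule walks_Cons_cases)
  let ?l = "linepath (barycenter \<sigma>) (barycenter \<mu>)"
  have "path_image (wpath \<sigma> [a]) \<subseteq> X"
    by (rule path_image_wpath[OF a])
  then have l: "path_image ?l \<subseteq> X"
    by (simp add: path_image_join \<mu>)
  then have "homotopic_paths X (?l +++ wpath \<mu> (p @ q)) (?l +++ (wpath \<mu> p +++ wpath \<rho> q))"
    using Cons.IH[OF p] by (intro homotopic_paths_join) auto
  also have "homotopic_paths X \<dots> ((?l +++ wpath \<mu> p) +++ wpath \<rho> q)"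
    using l p assms(2) by (intro homotopic_paths_assoc path_image_wpath) (auto simp: pathfinish_wpath path_image_wpath)
  finally show ?case
    by (simp add: \<mu>)
qed

lemma paths_closed_simplex:
  assumes "(\<sigma>, p, \<tau>) \<in> paths Q" "e \<in> set p"
  shows "\<sigma> \<subseteq> fst e \<and> fst e \<subseteq> snd e \<and> snd e \<subseteq> \<tau> \<and> \<sigma> \<noteq> {} \<and> \<tau> \<in> S"
proof -
  \<comment> \<open>The inclusion \<open>\<sigma> \<subseteq> \<tau>\<close> is carried along
    because it bounds the last arrow: after it the remaining path is trivial and has no arrows to
    speak of.\<close>
  have *: "(\<sigma>, p, \<tau>) \<in> paths Q \<Longrightarrow> \<sigma> \<noteq> {} \<and> \<sigma> \<subseteq> \<tau> \<and> \<tau> \<in> S \<and> (\<forall>e\<in>set p. \<sigma> \<subseteq> fst e \<and> fst e \<subseteq> snd e \<and> snd e \<subseteq> \<tau>)"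
    for \<sigma> p
  proof (induction p arbitrary: \<sigma>)
    case (Cons e p)
    then have "fst e = \<sigma>" "e \<in> arcs Q" "(snd e, p, \<tau>) \<in> paths Q"
      by (auto simp: paths_def awalk_Cons_iff)
    moreover have e: "\<sigma> \<noteq> {}" "\<sigma> \<subseteq> snd e"
      using calculation(1,2) arcs_Q[of \<sigma> "snd e"] prod.collapse[of e] by auto
    moreover note IH = Cons.IH[of "snd e"]
    moreover have "\<sigma> \<subseteq> fst e'" if "e' \<in> set p" for e'
      using IH[OF calculation(3)] that e(2) by (meson order_trans)
    moreover have "\<sigma> \<subseteq> \<tau>"
      using IH[OF calculation(3)] e(2) by (meson order_trans)
    ultimately show ?case
      by simp
  qed (auto simp: paths_def awalk_Nil_iff verts_Q)
  show ?thesis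
    using *[OF assms(1)] assms(2) by blast
qed

lemma path_image_wpath_path:
  assumes "(\<sigma>, p, \<tau>) \<in> paths Q"
  shows "path_image (wpath \<sigma> (map Inl p)) \<subseteq> closed_simplex \<tau>"
proof (rule path_image_wpath_arrows)
  show w: "(\<sigma>, map Inl p, \<tau>) \<in> walks Q"
    using walk_of_path_in_walks[OF assms] by simp
  have \<tau>: "\<tau> \<in> S - {{}}" "\<sigma> \<in> S - {{}}"
    using walks_verts[OF w] by (simp_all add: verts_Q)
  have "\<sigma> \<subseteq> \<tau>"
  proof (cases p)
    case Nil
    then show ?thesis
      using assms by (simp add: paths_def awalk_Nil_iff)
  next
    case (Cons e p')
    then show ?thesis
      using paths_closed_simplex[OF assms, of e] by auto
  qed
  then show "barycenter \<sigma> \<in> closed_simplex \<tau>"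
    using \<tau> by (intro barycenter_in_closed_simplex) auto
  show "closed_simplex (snd e) \<subseteq> closed_simplex \<tau>" if "a \<in> set (map Inl p)" "a = Inl e \<or> a = Inr e" for a e
    using that paths_closed_simplex[OF assms, of e] by (auto simp: closed_simplex_def)
qed

text \<open>Checked on the generating clauses. Backtracking along an arrow and the two sides of a
  relation stay in one closed simplex, which is convex; the other clauses are formal properties of
  homotopy.\<close>

lemma homotopic_wpath:
  assumes "walk_equiv Q I w w'"
  shows "homotopic_paths X (wpath (fst w) (fst (snd w))) (wpath (fst w') (fst (snd w')))"
proof -
  have simplex: "homotopic_paths X p q"
    if "\<sigma> \<in> S - {{}}" "path p" "path q" "path_image p \<subseteq> closed_simplex \<sigma>" "path_image q \<subseteq> closed_simplex \<sigma>"
      "pathstart q = pathstart p" "pathfinish q = pathfinish p" for p q \<sigma>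
  proof (rule homotopic_paths_starlike[of "closed_simplex \<sigma>"])
    show "starlike (closed_simplex \<sigma>)"
      using that convex_closed_simplex[OF finite_simplex] barycenter_in_closed_simplex[of \<sigma> \<sigma>]
      by (intro convex_imp_starlike) auto
  qed (use that closed_simplex_subset_realization in auto)
  have arc: "homotopic_paths X (wpath \<sigma> [b, c]) (wpath \<sigma> [])"
    if "(\<sigma>, [b, c], \<sigma>) \<in> walks Q" "a \<in> arcs Q" "{b, c} = {Inl a, Inr a}" for \<sigma> a b c
  proof (rule simplex)
    have a: "snd a \<in> S - {{}}" "fst a \<subseteq> snd a" "fst a \<noteq> {}"
      using arcs_Q[of "fst a" "snd a"] that by auto
    then show "snd a \<in> S - {{}}"
      by simp
    have "\<sigma> = fst a \<or> \<sigma> = snd a"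
      using that by (auto simp: walks_simps doubleton_eq_iff)
    then have b: "barycenter \<sigma> \<in> closed_simplex (snd a)"
      using a by (auto intro!: barycenter_in_closed_simplex)
    then show "path_image (wpath \<sigma> []) \<subseteq> closed_simplex (snd a)"
      by simp
    show "path_image (wpath \<sigma> [b, c]) \<subseteq> closed_simplex (snd a)"
      using that(3) by (intro path_image_wpath_arrows[OF that(1) b]) (auto simp: doubleton_eq_iff)
    show "pathfinish (wpath \<sigma> []) = pathfinish (wpath \<sigma> [b, c])"
      using pathfinish_wpath[OF that(1)] by simp
  qed auto
  show ?thesis
    using assms
  proof induction
    case (refl w)
    then show ?case
      by (cases w) (auto simp: path_image_wpath)
  next
    case (sym w w')
    then show ?case
      using homotopic_paths_sym by blast
  next
    case (trans w w' w'')
    then show ?case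
      using homotopic_paths_trans by blast
  next
    case (arrow_inverse a)
    then show ?case
      using walk_equiv_parallel[OF walk_equiv.arrow_inverse[OF arrow_inverse]]
        arc[of "snd a" "Inr a" "Inl a" a] arrow_inverse by (simp add: insert_commute linepath_refl)
  next
    case (inverse_arrow a)
    then show ?case
      using walk_equiv_parallel[OF walk_equiv.inverse_arrow[OF inverse_arrow]]
        arc[of "fst a" "Inl a" "Inr a" a] inverse_arrow by (simp add: linepath_refl)
  next
    case (relation f p q)
    obtain \<sigma> p' \<tau> q' where pq: "p = (\<sigma>, p', \<tau>)" "q = (\<sigma>, q', \<tau>)"
      using minimal_relation_parallel[OF relation] by (cases p; cases q) auto
    have "f \<in> I"
      using relation by (simp add: minimal_relation_def)
    then have paths: "(\<sigma>, p', \<tau>) \<in> paths Q" "(\<sigma>, q', \<tau>) \<in> paths Q"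
      using relation keys_in_ideal pq by auto
    have w: "(\<sigma>, map Inl p', \<tau>) \<in> walks Q" "(\<sigma>, map Inl q', \<tau>) \<in> walks Q"
      using walk_of_path_in_walks[OF paths(1)] walk_of_path_in_walks[OF paths(2)] by simp_all
    have "\<tau> \<in> S - {{}}"
      using walks_verts[OF w(1)] by (simp add: verts_Q)
    then show ?case
      unfolding pq walk_of_path.simps fst_conv snd_conv
      by (rule simplex[OF _ path_wpath path_wpath path_image_wpath_path[OF paths(1)] path_image_wpath_path[OF paths(2)]])
        (simp_all add: pathfinish_wpath[OF w(1)] pathfinish_wpath[OF w(2)])
  next
    case (congruence w w' u v)
    note par = walk_equiv_parallel[OF congruence(1)]
    obtain \<sigma> x \<tau> where w: "w = (\<sigma>, x, \<tau>)"
      by (cases w)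
    with par obtain y where w': "w' = (\<sigma>, y, \<tau>)"
      by (cases w') auto
    obtain u' \<upsilon> \<rho> v' where uv: "u = (\<tau>, u', \<upsilon>)" "v = (\<rho>, v', \<sigma>)"
      using congruence(4,5) by (cases u; cases v) (auto simp: w)
    note eq = w w' uv
    have walks: "(\<rho>, v', \<sigma>) \<in> walks Q" "(\<sigma>, x, \<tau>) \<in> walks Q" "(\<sigma>, y, \<tau>) \<in> walks Q" "(\<tau>, u', \<upsilon>) \<in> walks Q"
      using par congruence(2,3) by (simp_all add: eq)
    have *: "homotopic_paths X (wpath \<rho> (v' @ z @ u')) (wpath \<rho> v' +++ (wpath \<sigma> z +++ wpath \<tau> u'))"
      if z: "(\<sigma>, z, \<tau>) \<in> walks Q" for z
    proof -
      have "homotopic_paths X (wpath \<rho> (v' @ z @ u')) (wpath \<rho> v' +++ wpath \<sigma> (z @ u'))"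
        by (rule homotopic_wpath_append[OF walks(1) walks_append[OF z walks(4)]])
      also have "homotopic_paths X \<dots> (wpath \<rho> v' +++ (wpath \<sigma> z +++ wpath \<tau> u'))"
        using walks by (intro homotopic_paths_join homotopic_wpath_append[OF z])
          (auto simp: path_image_wpath pathfinish_wpath)
      finally show ?thesis .
    qed
    have "homotopic_paths X (wpath \<rho> v' +++ (wpath \<sigma> x +++ wpath \<tau> u')) (wpath \<rho> v' +++ (wpath \<sigma> y +++ wpath \<tau> u'))"
      using walks congruence.IH
      by (intro homotopic_paths_join) (auto simp: eq path_image_wpath pathfinish_wpath)
    then show ?case
      using homotopic_paths_trans[OF *[OF walks(2)] homotopic_paths_trans[OF _ homotopic_paths_sym[OF *[OF walks(3)]]]]
      by (simp add: eq)
  qed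
qed

end

section \<open>Comparing a path with the polygon of its walk\<close>

lemma homotopic_paths_cancel_right:
  fixes X :: "'a::real_normed_vector set"
  assumes h: "homotopic_paths X (p +++ r) (q +++ r)"
    and p: "path p" "path_image p \<subseteq> X" and q: "path q" "path_image q \<subseteq> X" and r: "path r" "path_image r \<subseteq> X"
    and ends: "pathfinish p = pathstart r" "pathfinish q = pathstart r"
  shows "homotopic_paths X p q"
proof -
  have *: "homotopic_paths X s ((s +++ r) +++ reversepath r)"
    if s: "path s" "path_image s \<subseteq> X" "pathfinish s = pathstart r" for s
  proof -
    have "homotopic_paths X s (s +++ linepath (pathfinish s) (pathfinish s))"
      using s by (intro homotopic_paths_sym[OF homotopic_paths_rid])
    also have "homotopic_paths X \<dots> (s +++ (r +++ reversepath r))"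
      using s homotopic_paths_sym[OF homotopic_paths_rinv[OF r]] by (intro homotopic_paths_join) auto
    also have "homotopic_paths X \<dots> ((s +++ r) +++ reversepath r)"
      using s r by (intro homotopic_paths_assoc) auto
    finally show ?thesis .
  qed
  have "homotopic_paths X p ((p +++ r) +++ reversepath r)"
    using p ends by (intro *)
  also have "homotopic_paths X \<dots> ((q +++ r) +++ reversepath r)"
    using r ends by (intro homotopic_paths_join[OF h]) auto
  also have "homotopic_paths X \<dots> q"
    using q ends by (intro homotopic_paths_sym[OF *])
  finally show ?thesis .
qed

context complex_quiver
begin

text \<open>The closed star, the union of the closed simplexes containing \<open>v\<close>. Polygons
  can be placed in it simplex by simplex, which the open star does not allow.\<close>

definition star :: "'v \<Rightarrow> ('v \<Rightarrow>\<^sub>0 real) set" where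
  "star v = {x \<in> X. insert v (Poly_Mapping.keys x) \<in> S}"

lemma star_subset: "star v \<subseteq> X"
  by (auto simp: star_def)

lemma closed_simplex_subset_star:
  assumes "\<sigma> \<in> S" "v \<in> \<sigma>"
  shows "closed_simplex \<sigma> \<subseteq> star v"
proof
  fix x :: "'v \<Rightarrow>\<^sub>0 real" assume x: "x \<in> closed_simplex \<sigma>"
  then have "insert v (Poly_Mapping.keys x) \<subseteq> \<sigma>"
    using assms by (auto simp: closed_simplex_def)
  then show "x \<in> star v"
    using x face[OF assms(1)] closed_simplex_subset_realization[OF assms(1)] by (auto simp: star_def)
qed

text \<open>The centre is the vertex \<open>v\<close>: every point of the star shares a closed
  simplex with it.\<close>

lemma starlike_star:
  assumes "{v} \<in> S"
  shows "starlike (star v)"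
  unfolding starlike_def
proof (intro bexI ballI)
  show "barycenter {v} \<in> star v"
    using barycenter_in_closed_simplex[of "{v}" "{v}"] closed_simplex_subset_star[OF assms] assms by auto
  fix x assume x: "x \<in> star v"
  let ?\<sigma> = "insert v (Poly_Mapping.keys x)"
  have \<sigma>: "?\<sigma> \<in> S"
    using x by (simp add: star_def)
  then have "closed_segment (barycenter {v}) x \<subseteq> closed_simplex ?\<sigma>"
    using x convex_closed_simplex[OF finite_simplex[OF \<sigma>]]
    by (intro closed_segment_subset barycenter_in_closed_simplex in_closed_simplex) (auto simp: star_def)
  then show "closed_segment (barycenter {v}) x \<subseteq> star v"
    using closed_simplex_subset_star[OF \<sigma>] by blast
qed

lemma arrows_up:
  assumes "\<sigma> \<subseteq> \<tau>" "\<sigma> \<noteq> {}" "\<tau> \<in> S" "a \<in> set (up \<sigma> \<tau>)"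
  obtains e where "a = Inl e" "\<sigma> \<subseteq> snd e" "snd e \<in> S"
proof -
  have "(\<sigma>, SOME p. (\<sigma>, p, \<tau>) \<in> paths Q, \<tau>) \<in> paths Q"
    by (rule someI_ex[OF path_exists[OF assms(1-3)]])
  from paths_closed_simplex[OF this] that assms(4) face[OF assms(3)] show thesis
    unfolding up_def by fastforce
qed

text \<open>The larger end of every arrow involved contains \<open>\<sigma> \<inter> \<tau>\<close>,
  hence \<open>v\<close>, so its closed simplex belongs to the star.\<close>

lemma path_image_wpath_tr:
  assumes S: "\<sigma> \<in> S" "\<tau> \<in> S" and v: "v \<in> \<sigma>" "v \<in> \<tau>"
  shows "path_image (wpath \<sigma> (tr \<sigma> \<tau>)) \<subseteq> star v"
proof (rule path_image_wpath_arrows)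
  show "(\<sigma>, tr \<sigma> \<tau>, \<tau>) \<in> walks Q"
    using S v by (intro walks_tr) auto
  show "barycenter \<sigma> \<in> star v"
    using S v barycenter_in_closed_simplex[of \<sigma> \<sigma>] closed_simplex_subset_star[of \<sigma> v] by auto
  fix a e assume a: "a \<in> set (tr \<sigma> \<tau>)" and e: "a = Inl e \<or> a = Inr e"
  have "a \<in> set (up (\<sigma> \<inter> \<tau>) \<tau>) \<or> case_sum Inr Inl a \<in> set (up (\<sigma> \<inter> \<tau>) \<sigma>)"
  proof -
    have "case_sum Inr Inl (case_sum Inr Inl b) = b" for b :: "'v set \<times> 'v set + 'v set \<times> 'v set"
      by (cases b) auto
    then show ?thesis
      using a by (auto simp: tr_def wrev_def)
  qed
  then have "\<sigma> \<inter> \<tau> \<subseteq> snd e \<and> snd e \<in> S"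
  proof
    assume "a \<in> set (up (\<sigma> \<inter> \<tau>) \<tau>)"
    then show ?thesis
      by (rule arrows_up[rotated 3]) (use S v e in auto)
  next
    assume "case_sum Inr Inl a \<in> set (up (\<sigma> \<inter> \<tau>) \<sigma>)"
    then show ?thesis
      by (rule arrows_up[rotated 3]) (use S v e in auto)
  qed
  then show "closed_simplex (snd e) \<subseteq> star v"
    using v by (intro closed_simplex_subset_star) auto
qed

text \<open>The segments \<open>l j\<close> from a point of the path to the barycenter of its
  carrier are rungs between path and polygon. Squares are filled one after the other along the
  subdivision, and the two outer rungs remain in the statement.\<close>

lemma homotopic_wpath_hol:
  assumes p: "path p" "path_image p \<subseteq> X" and n: "star_fine n p"
  shows "homotopic_paths X
    (p +++ linepath (pathfinish p) (barycenter (Poly_Mapping.keys (pathfinish p))))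
    (linepath (pathstart p) (barycenter (Poly_Mapping.keys (pathstart p))) +++
      wpath (Poly_Mapping.keys (pathstart p)) (hol n p))"
proof -
  define t where "t j = real j / real n" for j
  define s where "s j = Poly_Mapping.keys (p (t j))" for j
  define l where "l j = linepath (p (t j)) (barycenter (s j))" for j
  have n0: "0 < n"
    using n by (simp add: star_fine_def)
  have t: "t j \<in> {0..1}" if "j \<le> n" for j
    using that n0 by (simp add: t_def)
  have pX: "p (t j) \<in> X" if "j \<le> n" for j
    using p(2) t[OF that] by (auto simp: path_image_def)
  have s: "s j \<in> S" "s j \<noteq> {}" if "j \<le> n" for j
    using keys_in_complex[OF pX[OF that]] by (auto simp: s_def simp del: keys_eq_empty)
  have l_simplex: "path_image (l j) \<subseteq> closed_simplex (s j)" if "j \<le> n" for j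
    unfolding l_def using pX[OF that] s[OF that]
    by (intro path_image_linepath_closed_simplex in_closed_simplex barycenter_in_closed_simplex) (auto simp: s_def)
  have l: "path (l j)" "pathstart (l j) = p (t j)" "pathfinish (l j) = barycenter (s j)" for j
    by (simp_all add: l_def)
  have lX: "path_image (l j) \<subseteq> X" if "j \<le> n" for j
    using l_simplex[OF that] closed_simplex_subset_realization s[OF that] by blast
  have sub: "path (subpath (t i) (t j) p)" "path_image (subpath (t i) (t j) p) \<subseteq> X" if "i \<le> n" "j \<le> n" for i j
    using path_subpath[OF p(1) t[OF that(1)] t[OF that(2)]] path_image_subpath_subset[OF t[OF that(1)] t[OF that(2)], of p] p(2)
    by auto
  have cell: "\<exists>v. \<forall>u\<in>{t j..t (Suc j)}. v \<in> Poly_Mapping.keys (p u)" if "j < n" for j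
    using n that unfolding star_fine_def t_def by blast
  have tt: "t j \<le> t (Suc j)" for j
    by (simp add: t_def divide_right_mono)
  have t_0: "t 0 = 0" and t_n: "t n = 1"
    using n0 by (simp_all add: t_def)
  have walk: "(s 0, gw s j, s j) \<in> walks Q" if "j \<le> n" for j
  proof (rule walks_gw)
    show "s i \<in> S - {{}}" if "i \<le> j" for i
      using s[of i] that \<open>j \<le> n\<close> by auto
    show "s i \<inter> s (Suc i) \<noteq> {}" if "i < j" for i
    proof -
      obtain v where "\<forall>u\<in>{t i..t (Suc i)}. v \<in> Poly_Mapping.keys (p u)"
        using cell[of i] \<open>i < j\<close> \<open>j \<le> n\<close> by auto
      then have "v \<in> s i" "v \<in> s (Suc i)"
        unfolding s_def using tt[of i] by auto
      then show ?thesis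
        by blast
    qed
  qed
  have main: "homotopic_paths X (subpath (t 0) (t j) p +++ l j) (l 0 +++ wpath (s 0) (gw s j))" if "j \<le> n" for j
    using that
  proof (induction j)
    case 0
    show ?case
    proof (rule homotopic_paths_starlike[of "closed_simplex (s 0)"])
      have b: "barycenter (s 0) \<in> closed_simplex (s 0)" "p (t 0) \<in> closed_simplex (s 0)"
        using s[of 0] pX[of 0] by (auto intro: barycenter_in_closed_simplex in_closed_simplex simp: s_def)
      show "starlike (closed_simplex (s 0))"
        using convex_closed_simplex[OF finite_simplex[OF s(1)[of 0]]] b by (intro convex_imp_starlike) auto
      show "closed_simplex (s 0) \<subseteq> X"
        using s[of 0] closed_simplex_subset_realization by auto
      have c: "subpath (t 0) (t 0) p = linepath (p (t 0)) (p (t 0))"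
        by (simp add: subpath_refl)
      show "path (subpath (t 0) (t 0) p +++ l 0)" "path (l 0 +++ wpath (s 0) (gw s 0))"
        unfolding c using l by simp_all
      show "path_image (subpath (t 0) (t 0) p +++ l 0) \<subseteq> closed_simplex (s 0)"
        "path_image (l 0 +++ wpath (s 0) (gw s 0)) \<subseteq> closed_simplex (s 0)"
        unfolding c using l l_simplex[of 0] b by (simp_all add: path_image_join)
      show "pathstart (l 0 +++ wpath (s 0) (gw s 0)) = pathstart (subpath (t 0) (t 0) p +++ l 0)"
        "pathfinish (l 0 +++ wpath (s 0) (gw s 0)) = pathfinish (subpath (t 0) (t 0) p +++ l 0)"
        unfolding c pathstart_join pathfinish_join pathstart_linepath gw_0 wpath.simps pathfinish_linepath l
        by simp_all
    qed
  next
    case (Suc j)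
    then have j: "j < n" "j \<le> n" "Suc j \<le> n" "0 \<le> n"
      by auto
    obtain v where v: "\<forall>u\<in>{t j..t (Suc j)}. v \<in> Poly_Mapping.keys (p u)"
      using cell[OF j(1)] by blast
    then have vs: "v \<in> s j" "v \<in> s (Suc j)"
      unfolding s_def using tt[of j] by auto
    let ?A = "subpath (t 0) (t j) p" and ?B = "subpath (t j) (t (Suc j)) p"
    let ?W = "wpath (s 0) (gw s j)" and ?T = "wpath (s j) (tr (s j) (s (Suc j)))"
    have trw: "(s j, tr (s j) (s (Suc j)), s (Suc j)) \<in> walks Q"
      using s[OF j(2)] s[OF j(3)] vs by (intro walks_tr) auto
    have WX: "path_image ?W \<subseteq> X" "path_image ?T \<subseteq> X"
      using path_image_wpath[OF walk[OF j(2)]] path_image_wpath[OF trw] by auto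
    have ends: "pathfinish ?W = barycenter (s j)" "pathfinish ?T = barycenter (s (Suc j))"
      using pathfinish_wpath[OF walk[OF j(2)]] pathfinish_wpath[OF trw] by auto
    \<comment> \<open>One square: a piece of \<open>p\<close> and the next rung against the previous
      rung and the polygon of the transport. All four sides lie in the star of
      \<open>v\<close>.\<close>
    have BL: "homotopic_paths X (?B +++ l (Suc j)) (l j +++ ?T)"
    proof (rule homotopic_paths_starlike[of "star v"])
      have "{v} \<in> S"
        using face[OF s(1)[OF j(2)]] vs by blast
      then show "starlike (star v)"
        by (rule starlike_star)
      have "p u \<in> star v" if u: "u \<in> {t j..t (Suc j)}" for u
      proof -
        have "u \<in> {0..1}"
          using u t[OF j(2)] t[OF j(3)] by auto
        then have "p u \<in> X"
          using p(2) by (auto simp: path_image_def)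
        moreover have "insert v (Poly_Mapping.keys (p u)) = Poly_Mapping.keys (p u)"
          using v u by (intro insert_absorb) blast
        ultimately show ?thesis
          using keys_in_complex[of "p u"] by (simp add: star_def)
      qed
      then have B: "path_image ?B \<subseteq> star v"
        using path_image_subpath[of "t j" "t (Suc j)" p] tt[of j] by (auto simp: image_subset_iff)
      show "path_image (?B +++ l (Suc j)) \<subseteq> star v"
        using B l_simplex[OF j(3)] closed_simplex_subset_star[OF s(1)[OF j(3)] vs(2)]
        by (intro path_image_join_subset[THEN order_trans]) blast
      show "path_image (l j +++ ?T) \<subseteq> star v"
        using path_image_wpath_tr[OF s(1)[OF j(2)] s(1)[OF j(3)] vs] l_simplex[OF j(2)]
          closed_simplex_subset_star[OF s(1)[OF j(2)] vs(1)]
        by (intro path_image_join_subset[THEN order_trans]) blast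
    qed (use l sub[OF j(2,3)] star_subset ends in auto)
    have "homotopic_paths X (subpath (t 0) (t (Suc j)) p +++ l (Suc j)) ((?A +++ ?B) +++ l (Suc j))"
      using homotopic_paths_sym[OF homotopic_join_subpaths[OF p t[OF j(4)] t[OF j(2)] t[OF j(3)]]] l lX[OF j(3)]
      by (intro homotopic_paths_join) auto
    also have "homotopic_paths X \<dots> (?A +++ (?B +++ l (Suc j)))"
      using sub[OF j(4,2)] sub[OF j(2,3)] l lX[OF j(3)]
      by (intro homotopic_paths_sym[OF homotopic_paths_assoc]) auto
    also have "homotopic_paths X \<dots> (?A +++ (l j +++ ?T))"
      using sub[OF j(4,2)] l by (intro homotopic_paths_join[OF _ BL]) auto
    also have "homotopic_paths X \<dots> ((?A +++ l j) +++ ?T)"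
      using sub[OF j(4,2)] l lX[OF j(2)] WX by (intro homotopic_paths_assoc) auto
    also have "homotopic_paths X \<dots> ((l 0 +++ ?W) +++ ?T)"
      using WX l by (intro homotopic_paths_join[OF Suc.IH[OF j(2)]]) auto
    also have "homotopic_paths X \<dots> (l 0 +++ (?W +++ ?T))"
      using l lX[of 0] WX ends by (intro homotopic_paths_sym[OF homotopic_paths_assoc]) auto
    also have "homotopic_paths X \<dots> (l 0 +++ wpath (s 0) (gw s (Suc j)))"
      unfolding gw_Suc using homotopic_paths_sym[OF homotopic_wpath_append[OF walk[OF j(2)] trw]] l lX[of 0]
      by (intro homotopic_paths_join) auto
    finally show ?case .
  qed
  have "gw s n = hol n p"
    unfolding hol_def by (intro gw_cong) (simp add: s_def t_def)
  then show ?thesis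
    using main[of n] by (simp add: t_0 t_n l_def s_def pathstart_def pathfinish_def)
qed

text \<open>Common ends give both paths the same connecting segments, so once one polygon is
  replaced by the other only the final segment has to be cancelled.\<close>

lemma homotopic_if_weq_hol:
  assumes p: "path p" "path_image p \<subseteq> X" "star_fine n p" and q: "path q" "path_image q \<subseteq> X" "star_fine m q"
    and ends: "pathstart q = pathstart p" "pathfinish q = pathfinish p"
    and weq: "weq (Poly_Mapping.keys (pathstart p)) (Poly_Mapping.keys (pathfinish p)) (hol n p) (hol m q)"
  shows "homotopic_paths X p q"
proof -
  have linepath: "path_image (linepath x (barycenter (Poly_Mapping.keys x))) \<subseteq> X" if "x \<in> X" for x
  proof -
    have \<sigma>: "Poly_Mapping.keys x \<in> S" "Poly_Mapping.keys x \<noteq> {}"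
      using keys_in_complex[OF that] by (auto simp del: keys_eq_empty)
    then have "path_image (linepath x (barycenter (Poly_Mapping.keys x))) \<subseteq> closed_simplex (Poly_Mapping.keys x)"
      using that
      by (intro path_image_linepath_closed_simplex in_closed_simplex barycenter_in_closed_simplex) auto
    then show ?thesis
      using closed_simplex_subset_realization[OF \<sigma>(1)] by blast
  qed
  have X: "pathstart p \<in> X" "pathfinish p \<in> X"
    using p by auto
  let ?a = "pathstart p" and ?b = "pathfinish p"
  let ?la = "linepath ?a (barycenter (Poly_Mapping.keys ?a))" and ?lb = "linepath ?b (barycenter (Poly_Mapping.keys ?b))"
  have "homotopic_paths X (p +++ ?lb) (?la +++ wpath (Poly_Mapping.keys ?a) (hol n p))"
    by (rule homotopic_wpath_hol[OF p])
  also have "homotopic_paths X \<dots> (?la +++ wpath (Poly_Mapping.keys ?a) (hol m q))"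
    using homotopic_wpath[OF weq[unfolded weq_def]] linepath[OF X(1)] by (intro homotopic_paths_join) auto
  also have "homotopic_paths X \<dots> (q +++ ?lb)"
    using homotopic_paths_sym[OF homotopic_wpath_hol[OF q]] by (simp only: ends)
  finally show ?thesis
    using p q ends linepath[OF X(2)] by (intro homotopic_paths_cancel_right[of X p ?lb q]) auto
qed

text \<open>Passing to \<open>n * m\<close> pieces for both paths makes the exact formula for joins
  applicable; independence of the subdivision does the rest.\<close>

lemma weq_hol_join:
  assumes p: "path_image p \<subseteq> X" "star_fine n p" and q: "path_image q \<subseteq> X" "star_fine m q"
    and pq: "pathfinish p = pathstart q" and l: "star_fine l (p +++ q)"
  shows "weq (Poly_Mapping.keys (pathstart p)) (Poly_Mapping.keys (pathfinish q))
    (hol l (p +++ q)) (hol n p @ hol m q)"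
proof -
  have nm: "0 < n" "0 < m"
    using p q by (auto simp: star_fine_def)
  have fine: "star_fine (n * m) p" "star_fine (n * m) q"
    using star_fine_mult[OF p(2) nm(2)] star_fine_mult[OF q(2) nm(1)] by (simp_all add: mult.commute)
  have "path_image (p +++ q) \<subseteq> X"
    using p q path_image_join_subset[of p q] by blast
  from weq_hol_hol[OF l star_fine_join[OF fine pq] this]
  have "weq (Poly_Mapping.keys (pathstart p)) (Poly_Mapping.keys (pathfinish q))
      (hol l (p +++ q)) (hol (n * m) p @ hol (n * m) q)"
    using hol_join[of "n * m" p q] nm pq by simp
  also have "weq (Poly_Mapping.keys (pathstart p)) (Poly_Mapping.keys (pathfinish q)) \<dots> (hol n p @ hol m q)"
    using weq_hol_hol[OF fine(1) p(2,1)] weq_hol_hol[OF fine(2) q(2,1)] by (intro weq_append) (auto simp: pq)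
  finally show ?thesis .
qed

text \<open>Connectedness speaks of vertices, so each given simplex is linked to one of its
  vertices. A link of the vertex chain becomes an ascent to \<open>{u j, u (Suc j)}\<close> and a
  descent from it, also when the two vertices coincide.\<close>

lemma walk_exists:
  assumes conn: "connected_complex V S" and \<sigma>: "\<sigma> \<in> S - {{}}" and \<tau>: "\<tau> \<in> S - {{}}"
  shows "\<exists>w. (\<sigma>, w, \<tau>) \<in> walks Q"
proof -
  obtain a b where ab: "a \<in> \<sigma>" "b \<in> \<tau>"
    using \<sigma> \<tau> by blast
  then have "a \<in> V" "b \<in> V"
    using \<sigma> \<tau> simplex_subset by blast+
  then obtain n u where u: "u 0 = a" "u n = b" "\<And>i. i \<le> n \<Longrightarrow> u i \<in> V" "\<And>i. i < n \<Longrightarrow> {u i, u (Suc i)} \<in> S"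
    using conn unfolding connected_complex_def by blast
  have "\<exists>w. ({u 0}, w, {u j}) \<in> walks Q" if "j \<le> n" for j
    using that
  proof (induction j)
    case 0
    then show ?case
      using u(3)[of 0] vertex by (intro exI[of _ "[]"]) (simp add: walks_simps verts_Q)
  next
    case (Suc j)
    then obtain w where w: "({u 0}, w, {u j}) \<in> walks Q"
      by auto
    let ?e = "{u j, u (Suc j)}"
    have S: "{u j} \<in> S" "{u (Suc j)} \<in> S" "?e \<in> S"
      using u(3)[of j] u(3)[of "Suc j"] u(4)[of j] vertex Suc.prems by auto
    have "({u j}, tr {u j} ?e, ?e) \<in> walks Q" "(?e, tr ?e {u (Suc j)}, {u (Suc j)}) \<in> walks Q"
      using S by (auto intro!: walks_tr)
    then show ?case
      using walks_append w by blast
  qed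
  from this[of n] obtain w where w: "({a}, w, {b}) \<in> walks Q"
    using u by auto
  have "(\<sigma>, tr \<sigma> {a}, {a}) \<in> walks Q" "({b}, tr {b} \<tau>, \<tau>) \<in> walks Q"
    using \<sigma> \<tau> ab \<open>a \<in> V\<close> \<open>b \<in> V\<close> vertex by (auto intro!: walks_tr)
  then show ?thesis
    using walks_append w by blast
qed

end

section \<open>The isomorphism\<close>

text \<open>Multiplicativity and surjectivity are asked of representatives only up to equivalence.
  Preserving the relation makes the map on classes well defined, reflecting it makes it
  injective.\<close>

lemma class_group_iso:
  assumes R: "equiv L R" and f: "\<And>a a' b b'. \<lbrakk>(a, a') \<in> R; (b, b') \<in> R\<rbrakk> \<Longrightarrow> (f a b, f a' b') \<in> R"
    and R': "equiv L' R'" and f': "\<And>a a' b b'. \<lbrakk>(a, a') \<in> R'; (b, b') \<in> R'\<rbrakk> \<Longrightarrow> (f' a b, f' a' b') \<in> R'"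
    and \<phi>: "\<And>a. a \<in> L \<Longrightarrow> \<phi> a \<in> L'"
    and rel: "\<And>a b. a \<in> L \<Longrightarrow> b \<in> L \<Longrightarrow> (\<phi> a, \<phi> b) \<in> R' \<longleftrightarrow> (a, b) \<in> R"
    and hom: "\<And>a b. a \<in> L \<Longrightarrow> b \<in> L \<Longrightarrow> (\<phi> (f a b), f' (\<phi> a) (\<phi> b)) \<in> R'"
    and surj: "\<And>c. c \<in> L' \<Longrightarrow> \<exists>a\<in>L. (\<phi> a, c) \<in> R'"
  shows "class_group L R f e \<cong> class_group L' R' f' e'"
proof -
  let ?G = "class_group L R f e" and ?H = "class_group L' R' f' e'"
  \<comment> \<open>Saturating the image avoids a choice of representatives.\<close>
  define h where "h A = R' `` (\<phi> ` A)" for A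
  have h: "h (R `` {a}) = R' `` {\<phi> a}" if a: "a \<in> L" for a
  proof -
    have "R' `` {\<phi> b} = R' `` {\<phi> a}" if "b \<in> R `` {a}" for b
    proof -
      have "(a, b) \<in> R" "b \<in> L"
        using that equiv_class_subset[OF R] R by (auto simp: equiv_def refl_on_def)
      then have "(\<phi> a, \<phi> b) \<in> R'"
        using rel a by blast
      then show ?thesis
        using equiv_class_eq[OF R'] by blast
    qed
    then have "(\<Union>b\<in>R `` {a}. R' `` {\<phi> b}) = (\<Union>b\<in>R `` {a}. R' `` {\<phi> a})"
      by (rule SUP_cong[OF HOL.refl])
    moreover have "h (R `` {a}) = (\<Union>b\<in>R `` {a}. R' `` {\<phi> b})"
      unfolding h_def by blast
    ultimately show ?thesis
      using equiv_class_self[OF R a] by auto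
  qed
  have rep: "\<exists>a\<in>L. A = R `` {a}" if "A \<in> carrier ?G" for A
    using that by (auto simp: class_group_def elim: quotientE)
  have closed: "f a b \<in> L" if "a \<in> L" "b \<in> L" for a b
    using f[of a a b b] R that by (auto simp: equiv_def refl_on_def)
  have "h \<in> hom ?G ?H"
  proof (rule homI)
    fix A assume "A \<in> carrier ?G"
    then obtain a where "a \<in> L" "A = R `` {a}"
      using rep by blast
    then show "h A \<in> carrier ?H"
      using h \<phi> by (simp add: class_group_def quotientI)
  next
    fix A B assume "A \<in> carrier ?G" "B \<in> carrier ?G"
    then obtain a b where ab: "a \<in> L" "A = R `` {a}" "b \<in> L" "B = R `` {b}"
      using rep by meson
    have "h (A \<otimes>\<^bsub>?G\<^esub> B) = R' `` {\<phi> (f a b)}"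
      using ab by (simp add: class_group_mult[OF R f] h closed)
    also have "\<dots> = R' `` {f' (\<phi> a) (\<phi> b)}"
      using hom[OF ab(1,3)] equiv_class_eq[OF R'] by blast
    also have "\<dots> = h A \<otimes>\<^bsub>?H\<^esub> h B"
      using ab by (simp add: class_group_mult[OF R' f'] h \<phi>)
    finally show "h (A \<otimes>\<^bsub>?G\<^esub> B) = h A \<otimes>\<^bsub>?H\<^esub> h B" .
  qed
  moreover have "bij_betw h (carrier ?G) (carrier ?H)"
  proof (rule bij_betwI')
    fix A B assume "A \<in> carrier ?G" "B \<in> carrier ?G"
    then obtain a b where ab: "a \<in> L" "A = R `` {a}" "b \<in> L" "B = R `` {b}"
      using rep by meson
    then show "h A = h B \<longleftrightarrow> A = B"
      using eq_equiv_class_iff[OF R] eq_equiv_class_iff[OF R'] rel \<phi> by (simp add: h)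
  next
    fix A assume "A \<in> carrier ?G"
    then obtain a where "a \<in> L" "A = R `` {a}"
      using rep by blast
    then show "h A \<in> carrier ?H"
      using h \<phi> by (simp add: class_group_def quotientI)
  next
    fix B assume "B \<in> carrier ?H"
    then obtain c where c: "c \<in> L'" "B = R' `` {c}"
      by (auto simp: class_group_def elim: quotientE)
    then obtain a where a: "a \<in> L" "(\<phi> a, c) \<in> R'"
      using surj by blast
    then have "B = h (R `` {a})"
      using c equiv_class_eq[OF R'] by (simp add: h)
    then show "\<exists>A\<in>carrier ?G. B = h A"
      using a(1) by (auto simp: class_group_def quotientI)
  qed
  ultimately show ?thesis
    by (auto simp: is_iso_def iso_def)
qed

lemma equiv_homotopic_loops:
  "equiv (loops_at X x0) {(p, q). p \<in> loops_at X x0 \<and> q \<in> loops_at X x0 \<and> homotopic_paths X p q}"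
proof (rule equivI)
  show "trans {(p, q). p \<in> loops_at X x0 \<and> q \<in> loops_at X x0 \<and> homotopic_paths X p q}"
    by (rule transI) (blast intro: homotopic_paths_trans)
qed (auto simp: refl_on_def sym_def loops_at_def intro: homotopic_paths_sym)

lemma equiv_walk_loops:
  "equiv (walk_loops Q x) {(w, w'). w \<in> walk_loops Q x \<and> w' \<in> walk_loops Q x \<and> walk_equiv Q I w w'}"
proof (rule equivI)
  show "trans {(w, w'). w \<in> walk_loops Q x \<and> w' \<in> walk_loops Q x \<and> walk_equiv Q I w w'}"
    by (rule transI) (blast intro: walk_equiv.trans)
qed (auto simp: refl_on_def sym_def walk_loops_def intro: walk_equiv.refl walk_equiv.sym)

text \<open>The base points are unrelated, so loops at the carrier of \<open>x0\<close> are moved to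
  \<open>\<sigma>0\<close> by conjugation with a walk \<open>c\<close>, which exists by
  connectedness.\<close>

lemma (in complex_quiver) fundamental_group_iso:
  assumes conn: "connected_complex V S" and x0: "x0 \<in> X" and \<sigma>0: "\<sigma>0 \<in> S - {{}}"
  shows "fundamental_group X x0 \<cong> algebraic_fundamental_group Q I \<sigma>0"
proof -
  let ?\<kappa> = "Poly_Mapping.keys x0"
  obtain c where c: "(\<sigma>0, c, ?\<kappa>) \<in> walks Q"
    using walk_exists[OF conn \<sigma>0 keys_in_complex[OF x0]] by blast
  note c' = walks_wrev[OF c]
  define N where "N p = (SOME n. star_fine n p)" for p :: "real \<Rightarrow> 'v \<Rightarrow>\<^sub>0 real"
  define g where "g p = wrev (hol (N p) p)" for p
  define \<phi> where "\<phi> p = (\<sigma>0, c @ g p @ wrev c, \<sigma>0)" for p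
  have N: "star_fine (N p) p" if "p \<in> loops_at X x0" for p
    unfolding N_def using that by (intro someI_ex[OF star_fine_exists]) (auto simp: loops_at_def)
  have hol: "(?\<kappa>, hol n p, ?\<kappa>) \<in> walks Q" if "p \<in> loops_at X x0" "star_fine n p" for p n
    using walks_hol[OF that(2)] that(1) by (auto simp: loops_at_def)
  have hol_hol: "weq ?\<kappa> ?\<kappa> (hol n p) (hol (N p) p)" if "p \<in> loops_at X x0" "star_fine n p" for p n
    using weq_hol_hol[OF that(2) N[OF that(1)]] that(1) by (auto simp: loops_at_def)
  have g: "(?\<kappa>, g p, ?\<kappa>) \<in> walks Q" if "p \<in> loops_at X x0" for p
    unfolding g_def by (rule walks_wrev[OF hol[OF that N[OF that]]])
  have conj: "weq \<sigma>0 \<sigma>0 (c @ w @ wrev c) (c @ w' @ wrev c)" if "weq ?\<kappa> ?\<kappa> w w'" for w w'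
    using that c c' by (intro weq_append[OF weq_refl[OF c]] weq_append[OF _ weq_refl[OF c']])
  have join: "p +++ q \<in> loops_at X x0" if "p \<in> loops_at X x0" "q \<in> loops_at X x0" for p q
    using that by (simp add: loops_at_def path_image_join)
  have comp: "comp_path u v \<in> walk_loops Q \<sigma>0" if "u \<in> walk_loops Q \<sigma>0" "v \<in> walk_loops Q \<sigma>0" for u v
    using that by (auto simp: walk_loops_def intro: walks_append)
  have loops: "\<phi> p \<in> walk_loops Q \<sigma>0" if "p \<in> loops_at X x0" for p
    using walks_append[OF c walks_append[OF g[OF that] c']] by (simp add: \<phi>_def walk_loops_def)
  show ?thesis
    unfolding fundamental_group_def algebraic_fundamental_group_def
  proof (rule class_group_iso[OF equiv_homotopic_loops _ equiv_walk_loops _ loops])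
    let ?R = "{(p, q). p \<in> loops_at X x0 \<and> q \<in> loops_at X x0 \<and> homotopic_paths X p q}"
    let ?R' = "{(w, w'). w \<in> walk_loops Q \<sigma>0 \<and> w' \<in> walk_loops Q \<sigma>0 \<and> walk_equiv Q I w w'}"
    show "(a +++ b, a' +++ b') \<in> ?R" if "(a, a') \<in> ?R" "(b, b') \<in> ?R" for a a' b b'
      using that join homotopic_paths_join[of X a a' b b'] by (simp add: loops_at_def)
    show "(comp_path a b, comp_path a' b') \<in> ?R'" if "(a, a') \<in> ?R'" "(b, b') \<in> ?R'" for a a' b b'
    proof -
      from that obtain p p' q q' where
        [simp]: "a = (\<sigma>0, p, \<sigma>0)" "a' = (\<sigma>0, p', \<sigma>0)" "b = (\<sigma>0, q, \<sigma>0)" "b' = (\<sigma>0, q', \<sigma>0)"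
        by (auto simp: walk_loops_def)
      have "weq \<sigma>0 \<sigma>0 (q @ p) (q' @ p')"
        using that by (intro weq_append[where y = \<sigma>0]) (simp_all add: weq_def)
      then show ?thesis
        using that comp[of a b] comp[of a' b'] by (simp add: weq_def)
    qed
    show "(\<phi> p, \<phi> q) \<in> ?R' \<longleftrightarrow> (p, q) \<in> ?R" if p: "p \<in> loops_at X x0" and q: "q \<in> loops_at X x0" for p q
    proof
      assume "(\<phi> p, \<phi> q) \<in> ?R'"
      then have "weq \<sigma>0 \<sigma>0 (c @ (g p @ wrev c)) (c @ (g q @ wrev c))"
        by (simp add: \<phi>_def weq_def)
      then have "weq ?\<kappa> \<sigma>0 (g p @ wrev c) (g q @ wrev c)"
        using weq_cancel_left[OF c] walks_append[OF g c'] p q by blast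
      then have "weq ?\<kappa> ?\<kappa> (g p) (g q)"
        using weq_cancel_right[OF c'] g p q by blast
      then have "weq ?\<kappa> ?\<kappa> (hol (N p) p) (hol (N q) q)"
        using weq_wrev[of ?\<kappa> ?\<kappa> "g p" "g q"] by (simp add: g_def)
      then have "homotopic_paths X p q"
        using p q N[OF p] N[OF q] by (intro homotopic_if_weq_hol) (auto simp: loops_at_def)
      then show "(p, q) \<in> ?R"
        using p q by blast
    next
      assume "(p, q) \<in> ?R"
      then have "homotopic_paths X p q"
        by blast
      then obtain n where n: "star_fine n p" "star_fine n q"
        "weq (Poly_Mapping.keys (pathstart p)) (Poly_Mapping.keys (pathfinish p)) (hol n p) (hol n q)"
        by (rule weq_hol_homotopic)
      then have "weq ?\<kappa> ?\<kappa> (hol n p) (hol n q)"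
        using p by (simp add: loops_at_def)
      then have "weq ?\<kappa> ?\<kappa> (hol (N p) p) (hol (N q) q)"
        using weq_trans[OF weq_sym[OF hol_hol[OF p n(1)]] weq_trans[OF _ hol_hol[OF q n(2)]]] by blast
      then have "weq \<sigma>0 \<sigma>0 (c @ g p @ wrev c) (c @ g q @ wrev c)"
        unfolding g_def by (intro conj weq_wrev)
      then show "(\<phi> p, \<phi> q) \<in> ?R'"
        using loops[OF p] loops[OF q] by (simp add: \<phi>_def weq_def)
    qed
    show "(\<phi> (p +++ q), comp_path (\<phi> p) (\<phi> q)) \<in> ?R'"
      if p: "p \<in> loops_at X x0" and q: "q \<in> loops_at X x0" for p q
    proof -
      have "weq ?\<kappa> ?\<kappa> (hol (N (p +++ q)) (p +++ q)) (hol (N p) p @ hol (N q) q)"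
        using weq_hol_join[OF _ N[OF p] _ N[OF q] _ N[OF join[OF p q]]] p q by (auto simp: loops_at_def)
      then have "weq ?\<kappa> ?\<kappa> (g (p +++ q)) (g q @ g p)"
        using weq_wrev[of ?\<kappa> ?\<kappa>] by (fastforce simp: g_def)
      then have "weq \<sigma>0 \<sigma>0 (c @ g (p +++ q) @ wrev c) (c @ (g q @ g p) @ wrev c)"
        by (rule conj)
      \<comment> \<open>The trivial loop \<open>wrev c @ c\<close> is inserted between the factors,
        so that each is conjugated separately.\<close>
      also have "c @ (g q @ g p) @ wrev c = (c @ g q) @ ([] @ (g p @ wrev c))"
        by simp
      also have "weq \<sigma>0 \<sigma>0 \<dots> ((c @ g q) @ ((wrev c @ c) @ (g p @ wrev c)))"
        by (rule weq_append[OF weq_refl[OF walks_append[OF c g[OF q]]]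
              weq_append[OF weq_sym[OF weq_wrev_left[OF c]] weq_refl[OF walks_append[OF g[OF p] c']]]])
      finally show ?thesis
        using loops[OF join[OF p q]] comp[OF loops[OF p] loops[OF q]] by (simp add: \<phi>_def weq_def)
    qed
    show "\<exists>p\<in>loops_at X x0. (\<phi> p, u) \<in> ?R'" if "u \<in> walk_loops Q \<sigma>0" for u
    proof -
      from that obtain w where u: "u = (\<sigma>0, w, \<sigma>0)" "(\<sigma>0, w, \<sigma>0) \<in> walks Q"
        by (auto simp: walk_loops_def)
      \<comment> \<open>The given loop is conjugated back to the carrier of \<open>x0\<close>. Its
        inverse is the walk to realize, since \<open>g\<close> inverts.\<close>
      let ?w = "wrev c @ w @ c"
      have w: "(?\<kappa>, ?w, ?\<kappa>) \<in> walks Q"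
        by (intro walks_append[OF c'] walks_append[OF u(2) c])
      obtain p n where p: "path p" "path_image p \<subseteq> X" "pathstart p = x0" "pathfinish p = x0" "star_fine n p"
        and pw: "weq ?\<kappa> ?\<kappa> (hol n p) (wrev ?w)"
        using hol_surj[OF walks_wrev[OF w] x0 HOL.refl x0 HOL.refl] by blast
      then have loop: "p \<in> loops_at X x0"
        by (simp add: loops_at_def)
      have "weq ?\<kappa> ?\<kappa> (hol (N p) p) (wrev ?w)"
        using weq_trans[OF weq_sym[OF hol_hol[OF loop p(5)]] pw] .
      then have "weq ?\<kappa> ?\<kappa> (g p) ?w"
        unfolding g_def by (rule weq_wrev[where q = "wrev ?w", unfolded wrev_wrev])
      then have "weq \<sigma>0 \<sigma>0 (c @ g p @ wrev c) (c @ ?w @ wrev c)"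
        by (rule conj)
      also have "c @ ?w @ wrev c = (c @ wrev c) @ (w @ (c @ wrev c))"
        by simp
      also have "weq \<sigma>0 \<sigma>0 \<dots> ([] @ (w @ []))"
        by (rule weq_append[OF weq_wrev_right[OF c] weq_append[OF weq_refl[OF u(2)] weq_wrev_right[OF c]]])
      finally have "(\<phi> p, u) \<in> ?R'"
        using loops[OF loop] that by (simp add: \<phi>_def u weq_def)
      then show ?thesis
        using loop by blast
    qed
  qed
qed

theorem theorem2p2:
  fixes V :: "'v set" and S :: "'v set set"
    and x0 :: "'v \<Rightarrow>\<^sub>0 real" and \<sigma>0 :: "'v set"
  assumes "abstract_complex V S" "finite V" "V \<noteq> {}" "connected_complex V S"
    and "x0 \<in> geometric_realization S"
    and "\<sigma>0 \<in> Field (Pos S)"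
  shows "fundamental_group (geometric_realization S) x0
           \<cong> poset_fundamental_group TYPE('k::field) (Pos S) \<sigma>0"
proof -
  let ?Q = "ordered_quiver (Pos S)"
  interpret wf_digraph ?Q
    by (rule wf_digraph_ordered_quiver)
  \<comment> \<open>This makes the vertex set of the quiver finite, as the unit of the path algebra
    demands.\<close>
  have "finite S"
    using assms(1,2) finite_subset[of S "Pow V"] by (auto simp: abstract_complex_def)
  then interpret complex_quiver S "parallel_ideal ?Q :: (('v set, 'v set \<times> 'v set) qpath \<Rightarrow>\<^sub>0 'k) set" V
    by unfold_locales (use assms in \<open>simp_all add: ordered_quiver_def Field_Pos\<close>)
  show ?thesis
    unfolding poset_fundamental_group_def
    using assms(4-6) by (intro fundamental_group_iso) (simp_all add: Field_Pos)
qed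

end
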